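(* Let $p$ be an odd prime and let $n\geq 2$ be an integer. Let $L/K$ be a separable field extension of degree $p^n$, let $\widetilde{L}$ be its normal closure and $G=\operatorname{Gal}(\widetilde{L}/K)$. Then: 1) if $L/K$ is a Galois extension with cyclic Galois group, the number of Hopf Galois structures of cyclic type (that is, of type $C_{p^n}$) on $L/K$ is $p^{n-1}$; 2) if $G$ is isomorphic to the semidirect product $C_{p^n}\rtimes C_D$ of the cyclic group $C_{p^n}$ and a cyclic group $C_D$ of order $D$, with $D>1$ a divisor of $p-1$, the number of Hopf Galois structures of cyclic type on $L/K$ is $1$.
   Context: $C_m$ denotes the cyclic group of order $m$. In the semidirect product $C_{p^n}\rtimes C_D$, the morphism $C_D\to\operatorname{Aut}(C_{p^n})$ giving the action is injective. A Hopf Galois structure on a finite field extension $L/K$ is a pair $(\mathcal{H},\mu)$, where $\mathcal{H}$ is a finite cocommutative $K$-Hopf algebra and $\mu:\mathcal{H}\to \operatorname{End}_K(L)$ is a $K$-linear map giving $L$ a left $\mathcal{H}$-module algebra structure and inducing a $K$-vector space isomorphism $L\otimes_K \mathcal{H}\to \operatorname{End}_K(L)$. Let $L/K$ be finite separable of degree $g$ with normal closure $\widetilde{L}$, $G=\operatorname{Gal}(\widetilde{L}/K)$, $G'=\operatorname{Gal}(\widetilde{L}/L)$, and let $\lambda:G\hookrightarrow \operatorname{Sym}(G/G')\cong S_g$ be the action of $G$ on the left cosets $G/G'$. By the theorem of Greither and Pareigis, isomorphism classes of Hopf Galois structures on $L/K$ are in bijection with regular subgroups $N$ of $\operatorname{Sym}(G/G')$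 normalized by $\lambda(G)$ (the Hopf algebra corresponding to $N$ is $\widetilde{L}[N]^G$, with $G$ acting on $\widetilde{L}$ by automorphisms and on $N$ by conjugation through $\lambda$). The type of a Hopf Galois structure is the isomorphism class of the corresponding group $N$. Hopf Galois structures are counted up to isomorphism, i.e. the number of Hopf Galois structures of a given type is the number of such regular subgroups $N$ in the given isomorphism class. *)

theory Defs
  imports "HOL-Algebra.Algebra" "HOL-Algebra.Left_Coset" "HOL-Computational_Algebra.Primes"
begin

text \<open>Subfields are carrier sets; the field with carrier \<open>L\<close> is \<open>E\<lparr>carrier := L\<rparr>\<close>.\<close>

definition normal_extension :: "'a set \<Rightarrow> ('a, 'b) ring_scheme \<Rightarrow> bool" where
  "normal_extension K F \<longleftrightarrow>
     (\<forall>x \<in> carrier F. ring.algebraic F K x) \<and>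
     (\<forall>q \<in> carrier (univ_poly F K).
        pirreducible\<^bsub>F\<^esub> K q \<and> (\<exists>x \<in> carrier F. ring.eval F q x = \<zero>\<^bsub>F\<^esub>) \<longrightarrow>
        ring.splitted F q)"

text \<open>
  A polynomial is separable if its roots in a splitting field are simple. The field \<open>E\<close> provides
  the splitting field, so this expresses separability of \<open>L\<close> over \<open>K\<close> when \<open>E\<close> contains
  a normal closure of \<open>L\<close> over \<open>K\<close>.
\<close>
definition separable_extension :: "('a, 'b) ring_scheme \<Rightarrow> 'a set \<Rightarrow> 'a set \<Rightarrow> bool" where
  "separable_extension E K L \<longleftrightarrow>
     (\<forall>x \<in> L. ring.algebraic E K x \<and> ring.splitted E (ring.Irr E K x) \<and>
        (\<forall>a \<in> carrier E. ring.alg_mult E (ring.Irr E K x) a \<le> 1))"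

definition galois_extension :: "('a, 'b) ring_scheme \<Rightarrow> 'a set \<Rightarrow> 'a set \<Rightarrow> bool" where
  "galois_extension E K L \<longleftrightarrow>
     normal_extension K (E\<lparr>carrier := L\<rparr>) \<and> separable_extension E K L"

definition is_normal_closure :: "('a, 'b) ring_scheme \<Rightarrow> 'a set \<Rightarrow> 'a set \<Rightarrow> bool" where
  "is_normal_closure E K L \<longleftrightarrow>
     normal_extension K E \<and>
     (\<forall>M. subfield M E \<and> L \<subseteq> M \<and> normal_extension K (E\<lparr>carrier := M\<rparr>) \<longrightarrow> M = carrier E)"

definition galois_group :: "('a, 'b) ring_scheme \<Rightarrow> 'a set \<Rightarrow> ('a \<Rightarrow> 'a) monoid" where
  "galois_group F K =
     BijGroup (carrier F)
       \<lparr>carrier := {\<sigma> \<in> Bij (carrier F). \<sigma> \<in> ring_iso F F \<and> (\<forall>x \<in> K. \<sigma> x = x)}\<rparr>"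

definition semidirect_product ::
    "('a, 'm) monoid_scheme \<Rightarrow> ('b, 'n) monoid_scheme \<Rightarrow> ('b \<Rightarrow> 'a \<Rightarrow> 'a) \<Rightarrow> ('a \<times> 'b) monoid" where
  "semidirect_product A B \<phi> =
     \<lparr>carrier = carrier A \<times> carrier B,
      monoid.mult = (\<lambda>(a, b) (c, d). (a \<otimes>\<^bsub>A\<^esub> \<phi> b c, b \<otimes>\<^bsub>B\<^esub> d)),
      one = (\<one>\<^bsub>A\<^esub>, \<one>\<^bsub>B\<^esub>)\<rparr>"

definition coset_action :: "('g, 'm) monoid_scheme \<Rightarrow> 'g set \<Rightarrow> 'g \<Rightarrow> 'g set \<Rightarrow> 'g set" where
  "coset_action G H g = (\<lambda>C \<in> lcosets\<^bsub>G\<^esub> H. g <#\<^bsub>G\<^esub> C)"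

definition regular_subgroup :: "('x \<Rightarrow> 'x) set \<Rightarrow> 'x set \<Rightarrow> bool" where
  "regular_subgroup N \<Omega> \<longleftrightarrow>
     subgroup N (BijGroup \<Omega>) \<and> (\<forall>x \<in> \<Omega>. \<forall>y \<in> \<Omega>. \<exists>!\<eta>. \<eta> \<in> N \<and> \<eta> x = y)"

text \<open>
  Hopf Galois structures on a separable extension are counted up to isomorphism, through the
  Greither-Pareigis correspondence: with \<open>E\<close> the normal closure of \<open>L\<close> over \<open>K\<close>,
  \<open>G = Gal(E/K)\<close> and \<open>G' = Gal(E/L)\<close>, a structure is given by a regular subgroup \<open>N\<close> of
  \<open>Sym(G/G')\<close> normalized by the image of \<open>G\<close> (its Hopf algebra being the ring of
  \<open>G\<close>-invariants of the group algebra of \<open>N\<close> over \<open>E\<close>), and its type is the isomorphism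
  class of \<open>N\<close>.
\<close>
definition hopf_galois_structures ::
    "('a, 'b) ring_scheme \<Rightarrow> 'a set \<Rightarrow> 'a set \<Rightarrow> (('a \<Rightarrow> 'a) set \<Rightarrow> ('a \<Rightarrow> 'a) set) set set" where
  "hopf_galois_structures E K L =
     (let G = galois_group E K;
          G' = carrier (galois_group E L);
          \<Omega> = lcosets\<^bsub>G\<^esub> G';
          S = BijGroup \<Omega>
      in {N. regular_subgroup N \<Omega> \<and>
             (\<forall>g \<in> carrier G. \<forall>\<eta> \<in> N.
                coset_action G G' g \<otimes>\<^bsub>S\<^esub> \<eta> \<otimes>\<^bsub>S\<^esub> inv\<^bsub>S\<^esub> (coset_action G G' g) \<in> N)})"

definition hopf_galois_structures_of_type ::
    "('a, 'b) ring_scheme \<Rightarrow> 'a set \<Rightarrow> 'a set \<Rightarrow> ('t, 'm) monoid_scheme \<Rightarrow>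
     (('a \<Rightarrow> 'a) set \<Rightarrow> ('a \<Rightarrow> 'a) set) set set" where
  "hopf_galois_structures_of_type E K L T =
     {N \<in> hopf_galois_structures E K L.
        BijGroup (lcosets\<^bsub>galois_group E K\<^esub> (carrier (galois_group E L))) \<lparr>carrier := N\<rparr> \<cong> T}"

end

theory Submission
  imports Defs "HOL-Number_Theory.Cong"
begin

text \<open>
  Over a normal extension every embedding of an intermediate field extends to an automorphism, so
  counting the restrictions of automorphisms to \<open>L\<close> along a tower of simple extensions gives
  \<open>|G/G'| = [L:K] = p\<^sup>n\<close>. The rest is a count in \<open>Sym(G/G')\<close>. In both cases \<open>G\<close> contains an element
  \<open>c\<close> acting on \<open>G/G'\<close> as a \<open>p\<^sup>n\<close>-cycle. Let \<open>N\<close> be a cyclic regular subgroup normalized by \<open>c\<close>.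
  Label \<open>G/G'\<close> by \<open>\<int>/p\<^sup>n\<close> so that \<open>N\<close> acts by translations; then \<open>c\<close> becomes an affine map
  \<open>i \<mapsto> a i + b\<close>. As \<open>c\<close> is transitive, it has no fixed point modulo \<open>p\<close>, which forces \<open>a \<equiv> 1\<close>
  modulo \<open>p\<close> and makes \<open>b\<close> a unit, so that \<open>b = 1\<close> after rescaling. The label of \<open>c\<^sup>k\<close> applied to the
  base point is then \<open>1 + a + \<dots> + a\<^sup>k\<^sup>-\<^sup>1\<close>, so \<open>a\<close> determines \<open>N\<close>. Conversely, as \<open>p\<close> is odd, these sums run
  through all residues for every \<open>a \<equiv> 1\<close> modulo \<open>p\<close>. This gives \<open>p\<^sup>n\<^sup>-\<^sup>1\<close> subgroups in the cyclic case.
  In the semidirect case a nontrivial element of \<open>G'\<close> fixes the base point and conjugates \<open>c\<close> to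
  \<open>c\<^sup>r\<close> with \<open>r\<close> not congruent to 1 modulo \<open>p\<close>; if it normalizes \<open>N\<close>, then \<open>a\<^sup>r = a\<close>, hence \<open>a = 1\<close>.
\<close>

section \<open>Extending field embeddings\<close>

context field
begin

text \<open>
  A homomorphism over \<open>K\<close> from an intermediate ring, given by its graph: every condition involves only
  finitely many pairs, so it passes to unions of chains. Closure under inverses is not required, because
  an intermediate ring of an algebraic extension is a field.
\<close>

definition partial_embedding :: "'a set \<Rightarrow> ('a \<times> 'a) set \<Rightarrow> bool" where
  "partial_embedding K r \<longleftrightarrow>
     r \<subseteq> carrier R \<times> carrier R \<and> Id_on K \<subseteq> r \<and> (\<forall>b. (\<zero>, b) \<in> r \<longrightarrow> b = \<zero>) \<and>
     (\<forall>a b. (a, b) \<in> r \<longrightarrow> (\<ominus> a, \<ominus> b) \<in> r) \<and>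
     (\<forall>a b c d. (a, b) \<in> r \<and> (c, d) \<in> r \<longrightarrow> (a \<oplus> c, b \<oplus> d) \<in> r \<and> (a \<otimes> c, b \<otimes> d) \<in> r)"

section \<open>Partial embeddings as homomorphisms, and adjoining one element\<close>

lemma partial_embeddingD:
  assumes "partial_embedding K r"
  shows "\<And>a b. (a, b) \<in> r \<Longrightarrow> a \<in> carrier R" "\<And>a b. (a, b) \<in> r \<Longrightarrow> b \<in> carrier R"
    "\<And>k. k \<in> K \<Longrightarrow> (k, k) \<in> r" "\<And>b. (\<zero>, b) \<in> r \<Longrightarrow> b = \<zero>"
    "\<And>a b. (a, b) \<in> r \<Longrightarrow> (\<ominus> a, \<ominus> b) \<in> r"
    "\<And>a b c d. (a, b) \<in> r \<Longrightarrow> (c, d) \<in> r \<Longrightarrow> (a \<oplus> c, b \<oplus> d) \<in> r"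
    "\<And>a b c d. (a, b) \<in> r \<Longrightarrow> (c, d) \<in> r \<Longrightarrow> (a \<otimes> c, b \<otimes> d) \<in> r"
  using assms unfolding partial_embedding_def by blast+

text \<open>Subtracting the two pairs gives a pair over zero, whose second component must vanish.
  Single-valuedness is thus the triviality of the kernel.\<close>

lemma partial_embedding_unique:
  assumes "partial_embedding K r" "(a, b) \<in> r" "(a, b') \<in> r"
  shows "b = b'"
proof -
  note D = partial_embeddingD[OF assms(1)]
  have "(a \<oplus> \<ominus> a, b \<oplus> \<ominus> b') \<in> r"
    using D(5,6) assms(2,3) by blast
  moreover have c: "a \<in> carrier R" "b \<in> carrier R" "b' \<in> carrier R"
    using D(1,2) assms(2,3) by blast+
  ultimately have "(\<zero>, b \<ominus> b') \<in> r"
    using r_neg[of a] by (simp only: minus_eq)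
  then have "b \<ominus> b' = \<zero>" by (rule D(4))
  then show ?thesis using c(2,3) by simp
qed

text \<open>The domain is a subring above \<open>K\<close>. It is a field because each nonzero
  \<open>k\<close> in it is algebraic over \<open>K\<close>: its inverse lies in
  \<open>simple_extension K k\<close>, which every subring containing \<open>K\<close> and
  \<open>k\<close> contains.\<close>

lemma partial_embedding_obtain_hom:
  assumes "subfield K R" "partial_embedding K r"
    and alg: "\<forall>x \<in> carrier R. (algebraic over K) x"
  obtains s where "subfield (Domain r) R" "K \<subseteq> Domain r"
    "ring_hom_ring (R\<lparr>carrier := Domain r\<rparr>) R s"
    "\<And>a b. (a, b) \<in> r \<longleftrightarrow> a \<in> Domain r \<and> b = s a"
    "\<And>k. k \<in> K \<Longrightarrow> s k = k"
proof -
  note D = partial_embeddingD[OF assms(2)]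
  note K = subringE[OF subfieldE(1)[OF assms(1)]]
  have sr: "subring (Domain r) R"
  proof (rule subringI)
    show "\<one> \<in> Domain r" using D(3)[OF K(3)] by blast
    show "Domain r \<subseteq> carrier R" by (auto dest: D(1))
    show "\<ominus> a \<in> Domain r" if "a \<in> Domain r" for a
      using that by (auto dest: D(5))
    show "a \<otimes> b \<in> Domain r" "a \<oplus> b \<in> Domain r" if "a \<in> Domain r" "b \<in> Domain r" for a b
      using that D(6,7) by (meson Domain.simps)+
  qed
  have KD: "K \<subseteq> Domain r" using D(3) by blast
  have sf: "subfield (Domain r) R"
  proof (rule subfieldI'[OF sr])
    fix k assume k: "k \<in> Domain r - {\<zero>}"
    then have kc: "k \<in> carrier R" using D(1) by blast
    have "subfield (simple_extension K k) R"
      using simple_extension_is_subfield[OF assms(1) kc] bspec[OF alg kc] by blast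
    then have "inv k \<in> simple_extension K k"
      using subfield_m_inv(1)[of "simple_extension K k" k] simple_extension_mem[OF _ kc, of K]
        subfieldE(1)[OF assms(1)] k by auto
    then show "inv k \<in> Domain r"
      using simple_extension_subring_incl[OF sr KD, of k] k by auto
  qed
  define s where "s a = (THE b. (a, b) \<in> r)" for a
  have s: "s a = b" if "(a, b) \<in> r" for a b
    unfolding s_def using that partial_embedding_unique[OF assms(2)] by blast
  have s_in: "(a, s a) \<in> r" if "a \<in> Domain r" for a
    using that s by blast
  show ?thesis
  proof (rule that[OF sf KD])
    show "(a, b) \<in> r \<longleftrightarrow> a \<in> Domain r \<and> b = s a" for a b
      using s s_in by blast
    show "s k = k" if "k \<in> K" for k
      using s D(3) that by blast
    show "ring_hom_ring (R\<lparr>carrier := Domain r\<rparr>) R s"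
    proof (rule ring_hom_ringI)
      show "ring (R\<lparr>carrier := Domain r\<rparr>)" using subring_is_ring[OF sr] .
      show "ring R" by (rule ring_axioms)
      fix x y
      show "x \<in> carrier (R\<lparr>carrier := Domain r\<rparr>) \<Longrightarrow> s x \<in> carrier R"
        using D(2)[OF s_in] by simp
      assume "x \<in> carrier (R\<lparr>carrier := Domain r\<rparr>)" "y \<in> carrier (R\<lparr>carrier := Domain r\<rparr>)"
      then have "(x, s x) \<in> r" "(y, s y) \<in> r" using s_in by auto
      then show "s (x \<otimes>\<^bsub>R\<lparr>carrier := Domain r\<rparr>\<^esub> y) = s x \<otimes> s y"
        "s (x \<oplus>\<^bsub>R\<lparr>carrier := Domain r\<rparr>\<^esub> y) = s x \<oplus> s y"
        using s[OF D(7)] s[OF D(6)] by simp_all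
    next
      show "s \<one>\<^bsub>R\<lparr>carrier := Domain r\<rparr>\<^esub> = \<one>" using s[OF D(3)[OF K(3)]] by simp
    qed
  qed
qed

text \<open>Polynomials are coefficient lists with nonzero leading coefficient. A homomorphism out
  of a field keeps that coefficient nonzero, so the \<open>normalize\<close> in the general formulas
  for sums and products changes nothing here.\<close>

lemma map_hom_univ_poly:
  assumes N: "subfield N R" and s: "ring_hom_ring (R\<lparr>carrier := N\<rparr>) R s"
  shows "\<And>p. p \<in> carrier (N[X]) \<Longrightarrow> map s p \<in> carrier (poly_ring R)"
    and "\<And>p q. p \<in> carrier (N[X]) \<Longrightarrow> q \<in> carrier (N[X]) \<Longrightarrow>
           map s (p \<otimes>\<^bsub>N[X]\<^esub> q) = map s p \<otimes>\<^bsub>poly_ring R\<^esub> map s q"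
    and "\<And>p q. p \<in> carrier (N[X]) \<Longrightarrow> q \<in> carrier (N[X]) \<Longrightarrow>
           map s (p \<oplus>\<^bsub>N[X]\<^esub> q) = map s p \<oplus>\<^bsub>poly_ring R\<^esub> map s q"
proof -
  note sr = subfieldE(1)[OF N]
  interpret s: ring_hom_ring "R\<lparr>carrier := N\<rparr>" R s by fact
  interpret UP: ring "N[X]" using univ_poly_is_ring[OF sr] .
  show M: "map s p \<in> carrier (poly_ring R)" if "p \<in> carrier (N[X])" for p
    using polynomial_hom[OF s.homh subfield_iff(2)[OF N] field_axioms, of p] that
    by (simp add: univ_poly_consistent[OF sr])
  have S: "set p \<subseteq> N" if "p \<in> carrier (N[X])" for p
    using that polynomial_incl unfolding univ_poly_carrier[symmetric] by blast
  have n: "normalize (map s p) = map s p" if "p \<in> carrier (N[X])" for p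
    using M[OF that] normalize_polynomial unfolding univ_poly_carrier[symmetric] by blast
  fix p q assume p: "p \<in> carrier (N[X])" and q: "q \<in> carrier (N[X])"
  show "map s (p \<otimes>\<^bsub>N[X]\<^esub> q) = map s p \<otimes>\<^bsub>poly_ring R\<^esub> map s q"
    using s.poly_mult_hom'[of p q] S[OF p] S[OF q] n[OF UP.m_closed[OF p q]]
    by (simp add: univ_poly_mult poly_mult_consistent[OF sr] del: poly_mult.simps)
  show "map s (p \<oplus>\<^bsub>N[X]\<^esub> q) = map s p \<oplus>\<^bsub>poly_ring R\<^esub> map s q"
    using s.poly_add_hom'[of p q] S[OF p] S[OF q] n[OF UP.a_closed[OF p q]]
    by (simp add: univ_poly_add poly_add_consistent[OF sr] del: poly_add.simps)
qed

lemma eval_map_ring_hom: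
  assumes N: "subfield N R" and s: "ring_hom_ring (R\<lparr>carrier := N\<rparr>) R s" and w: "w \<in> carrier R"
  shows "(\<lambda>p. eval (map s p) w) \<in> ring_hom (N[X]) R"
proof -
  interpret s: ring_hom_ring "R\<lparr>carrier := N\<rparr>" R s by fact
  note e = ring_hom_memE[OF eval_is_hom[OF carrier_is_subring w]]
  note m = map_hom_univ_poly[OF N s]
  have "eval (map s \<one>\<^bsub>N[X]\<^esub>) w = \<one>"
    using s.hom_one w by (simp add: univ_poly_one)
  then show ?thesis
    using e m by (intro ring_hom_memI) auto
qed

text \<open>The extension of \<open>s\<close> sending \<open>z\<close> to \<open>w\<close>, written
  as the graph of all pairs \<open>(p(z), p^s(w))\<close>. This needs no choice of a polynomial
  representing an element, and \<open>ker\<close> is exactly the condition on pairs over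
  zero.\<close>

lemma partial_embedding_adjoin:
  assumes N: "subfield N R" and s: "ring_hom_ring (R\<lparr>carrier := N\<rparr>) R s"
    and K: "K \<subseteq> N" "\<And>k. k \<in> K \<Longrightarrow> s k = k"
    and zw: "z \<in> carrier R" "w \<in> carrier R"
    and ker: "\<And>p. p \<in> carrier (N[X]) \<Longrightarrow> eval p z = \<zero> \<Longrightarrow> eval (map s p) w = \<zero>"
  defines "r \<equiv> (\<lambda>p. (eval p z, eval (map s p) w)) ` carrier (N[X])"
  shows "partial_embedding K r" and "\<And>a. a \<in> N \<Longrightarrow> (a, s a) \<in> r" and "(z, w) \<in> r"
proof -
  note sr = subfieldE(1)[OF N]
  interpret s: ring_hom_ring "R\<lparr>carrier := N\<rparr>" R s by fact
  interpret UP: ring "N[X]" using univ_poly_is_ring[OF sr] .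
  interpret e: ring_hom_ring "N[X]" R "\<lambda>p. eval p z"
    using eval_ring_hom[OF sr zw(1)] .
  interpret f: ring_hom_ring "N[X]" R "\<lambda>p. eval (map s p) w"
    using ring_hom_ringI2[OF UP.ring_axioms ring_axioms eval_map_ring_hom[OF N s zw(2)]] .
  have r_in: "(eval p z, eval (map s p) w) \<in> r" if "p \<in> carrier (N[X])" for p
    unfolding r_def using that by (rule imageI)
  show const: "(a, s a) \<in> r" if "a \<in> N" for a
  proof -
    have ac: "a \<in> carrier R" "s a \<in> carrier R" using subfieldE(3)[OF N] s.hom_closed that by auto
    show ?thesis
    \<comment> \<open>The zero polynomial is the empty list; \<open>[a]\<close> is a polynomial only
      for nonzero \<open>a\<close>.\<close>
    proof (cases "a = \<zero>")
      case True
      then have "(a, s a) = (eval \<zero>\<^bsub>N[X]\<^esub> z, eval (map s \<zero>\<^bsub>N[X]\<^esub>) w)"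
        using s.hom_zero by (simp add: univ_poly_zero)
      then show ?thesis using r_in[OF UP.zero_closed] by (simp only:)
    next
      case False
      then have "[a] \<in> carrier (N[X])"
        using const_is_polynomial[of a N] that by (simp add: univ_poly_carrier[symmetric])
      from r_in[OF this] show ?thesis
        using zw ac by simp
    qed
  qed
  show "(z, w) \<in> r"
    using r_in[OF var_closed(1)[OF sr]] zw s.hom_one s.hom_zero by (simp add: var_def)
  show "partial_embedding K r"
    unfolding partial_embedding_def
  proof (intro conjI allI impI)
    show "r \<subseteq> carrier R \<times> carrier R" unfolding r_def using e.hom_closed f.hom_closed by auto
    show "Id_on K \<subseteq> r" 
    proof (rule subrelI)
      fix a b assume "(a, b) \<in> Id_on K"
      then have "a \<in> K" "b = a" by auto
      then show "(a, b) \<in> r" using const[of a] K by (metis subsetD)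
    qed
    show "b = \<zero>" if b: "(\<zero>, b) \<in> r" for b
    proof -
      obtain p where "p \<in> carrier (N[X])" "(\<zero>, b) = (eval p z, eval (map s p) w)"
        using b unfolding r_def by (rule imageE) blast
      then show ?thesis using ker[of p] by simp
    qed
    show "(\<ominus> a, \<ominus> b) \<in> r" if ab: "(a, b) \<in> r" for a b
    proof -
      obtain p where "p \<in> carrier (N[X])" "(a, b) = (eval p z, eval (map s p) w)"
        using ab unfolding r_def by (rule imageE) blast
      then have p: "p \<in> carrier (N[X])"
        "(\<ominus> a, \<ominus> b) = (eval (\<ominus>\<^bsub>N[X]\<^esub> p) z, eval (map s (\<ominus>\<^bsub>N[X]\<^esub> p)) w)"
        using e.hom_a_inv[of p] f.hom_a_inv[of p] by simp_all
      then show ?thesis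
        using r_in[OF UP.a_inv_closed[OF p(1)]] by (simp only: p(2))
    qed
    fix a b c d assume abcd: "(a, b) \<in> r \<and> (c, d) \<in> r"
    obtain p where p: "p \<in> carrier (N[X])" "(a, b) = (eval p z, eval (map s p) w)"
      using abcd[THEN conjunct1] unfolding r_def by (rule imageE) blast
    obtain q where q: "q \<in> carrier (N[X])" "(c, d) = (eval q z, eval (map s q) w)"
      using abcd[THEN conjunct2] unfolding r_def by (rule imageE) blast
    show "(a \<oplus> c, b \<oplus> d) \<in> r"
      using r_in[OF UP.a_closed[OF p(1) q(1)]] p q by simp
    show "(a \<otimes> c, b \<otimes> d) \<in> r"
      using r_in[OF UP.m_closed[OF p(1) q(1)]] p q by simp
  qed
qed

section \<open>Extending embeddings over a normal extension\<close>

definition normal_over :: "'a set \<Rightarrow> bool" where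
  "normal_over K \<longleftrightarrow> (\<forall>x \<in> carrier R. (algebraic over K) x \<and> splitted (Irr K x))"

text \<open>Let \<open>?f\<close> and \<open>?g\<close> be the minimal polynomials of
  \<open>z\<close> over the domain and over \<open>K\<close>. Then \<open>?f\<close> divides
  \<open>?g\<close>, and \<open>s\<close> fixes the coefficients of \<open>?g\<close>, so the image
  of \<open>?f\<close> divides \<open>?g\<close> too and has a root \<open>w\<close> because
  \<open>?g\<close> splits. Polynomials vanishing at \<open>z\<close> are multiples of
  \<open>?f\<close>, so their images vanish at \<open>w\<close>, and \<open>z\<close> can be sent to
  \<open>w\<close>.\<close>

lemma partial_embedding_extend:
  assumes K: "subfield K R" and n: "normal_over K" and r: "partial_embedding K r"
    and z: "z \<in> carrier R"
  shows "\<exists>r'. partial_embedding K r' \<and> r \<subseteq> r' \<and> z \<in> Domain r'"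
proof -
  have alg: "\<forall>x \<in> carrier R. (algebraic over K) x"
    using n unfolding normal_over_def by blast
  obtain s where N: "subfield (Domain r) R" and KN: "K \<subseteq> Domain r"
    and s: "ring_hom_ring (R\<lparr>carrier := Domain r\<rparr>) R s"
    and rs: "\<And>a b. (a, b) \<in> r \<longleftrightarrow> a \<in> Domain r \<and> b = s a" and sK: "\<And>k. k \<in> K \<Longrightarrow> s k = k"
    by (rule partial_embedding_obtain_hom[OF K r alg]; rule that; assumption)
  let ?N = "Domain r"
  note map_poly = map_hom_univ_poly[OF N s]
  interpret PN: ring "?N[X]" using univ_poly_is_ring[OF subfieldE(1)[OF N]] .
  interpret P: ring "poly_ring R" using univ_poly_is_ring[OF carrier_is_subring] .
  have algN: "(algebraic over ?N) z" using algebraic_mono[OF KN bspec[OF alg z]] .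
  note If = IrrE[OF N z algN] and Ig = IrrE[OF K z bspec[OF alg z]]
  let ?f = "Irr ?N z" and ?g = "Irr K z"
  have gN: "?g \<in> carrier (?N[X])"
    using Ig(1) KN unfolding univ_poly_carrier[symmetric] polynomial_def by blast
  have gR: "?g \<in> carrier (poly_ring R)"
    using carrier_polynomial_shell[OF subfieldE(1)[OF K] Ig(1)] .
  have gK: "set ?g \<subseteq> K"
    using Ig(1) polynomial_incl unfolding univ_poly_carrier[symmetric] by blast
  then have sg: "map s ?g = ?g"
    using sK by (intro map_idI) blast
  have gn: "?g \<noteq> []" using pirreducibleE(1)[OF subfieldE(1)[OF K] Ig(1,2)] by blast
  have "?f divides\<^bsub>?N[X]\<^esub> ?g"
    using Irr_minimal[OF N z algN gN Ig(4)] pdivides_iff_shell[OF N If(1) gN] by blast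
  then obtain q where q: "q \<in> carrier (?N[X])" "?g = ?f \<otimes>\<^bsub>?N[X]\<^esub> q"
    unfolding factor_def by blast
  have "?g = map s ?f \<otimes>\<^bsub>poly_ring R\<^esub> map s q"
    using map_poly(2)[OF If(1) q(1)] unfolding q(2)[symmetric] sg .
  then have "map s ?f pdivides ?g"
    unfolding pdivides_def factor_def using map_poly(1)[OF q(1)] by blast
  moreover have "splitted ?g" using n z unfolding normal_over_def by blast
  ultimately have "splitted (map s ?f)"
    using pdivides_imp_splitted[OF map_poly(1)[OF If(1)] gR gn] by blast
  moreover have "degree (map s ?f) \<ge> 1"
    using pirreducible_degree[OF N If(1,2)] by simp
  ultimately have "roots (map s ?f) \<noteq> {#}"
    unfolding splitted_def by (metis not_one_le_zero size_empty)
  then obtain w where "w \<in># roots (map s ?f)" by blast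
  then have w: "w \<in> carrier R" "eval (map s ?f) w = \<zero>"
    using roots_mem_iff_is_root[OF map_poly(1)[OF If(1)]] unfolding is_root_def by auto
  have ker: "eval (map s p) w = \<zero>" if p: "p \<in> carrier (?N[X])" and pz: "eval p z = \<zero>" for p
  proof -
    have "?f divides\<^bsub>?N[X]\<^esub> p"
      using Irr_minimal[OF N z algN p pz] pdivides_iff_shell[OF N If(1) p] by blast
    then obtain q where q: "q \<in> carrier (?N[X])" "p = ?f \<otimes>\<^bsub>?N[X]\<^esub> q"
      unfolding factor_def by blast
    note e = ring_hom_memE[OF eval_map_ring_hom[OF N s w(1)]]
    show ?thesis
      using e(1)[OF q(1)] e(2)[OF If(1) q(1)] q(2) w(2) by simp
  qed
  let ?r' = "(\<lambda>p. (eval p z, eval (map s p) w)) ` carrier (?N[X])"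
  have A: "partial_embedding K ?r'" "\<And>a. a \<in> ?N \<Longrightarrow> (a, s a) \<in> ?r'" "(z, w) \<in> ?r'"
    by (rule partial_embedding_adjoin[OF N s KN sK z w(1) ker]; assumption)+
  show ?thesis
  proof (intro exI conjI)
    show "partial_embedding K ?r'" by (rule A(1))
    show "r \<subseteq> ?r'"
    proof (rule subrelI)
      fix a b assume "(a, b) \<in> r"
      then have ab: "a \<in> ?N" "b = s a" using rs by blast+
      show "(a, b) \<in> ?r'" unfolding ab(2) by (rule A(2)[OF ab(1)])
    qed
    show "z \<in> Domain ?r'" using A(3) by (rule DomainI)
  qed
qed

text \<open>Zorn's lemma for the partial embeddings containing \<open>r\<close>; a maximal one is
  total by the one-element extension.\<close>

lemma partial_embedding_total:
  assumes K: "subfield K R" and n: "normal_over K" and r: "partial_embedding K r"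
  obtains t where "partial_embedding K t" "r \<subseteq> t" "Domain t = carrier R"
proof -
  let ?A = "{t. partial_embedding K t \<and> r \<subseteq> t}"
  have "\<exists>t\<in>?A. \<forall>u\<in>?A. t \<subseteq> u \<longrightarrow> u = t"
  proof (rule subset_Zorn_nonempty)
    show "?A \<noteq> {}" using r by blast
    fix C assume C: "C \<noteq> {}" "subset.chain ?A C"
    have pe: "partial_embedding K t" "r \<subseteq> t" if "t \<in> C" for t
      using C(2) that unfolding subset_chain_def by blast+
    have two: "\<exists>t\<in>C. u \<in> t \<and> v \<in> t" if "u \<in> \<Union>C" "v \<in> \<Union>C" for u v
      using that C(2) unfolding subset_chain_def by blast
    have "partial_embedding K (\<Union>C)"
      unfolding partial_embedding_def
    proof (intro conjI allI impI)
      show "\<Union>C \<subseteq> carrier R \<times> carrier R" using pe(1) unfolding partial_embedding_def by blast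
      show "Id_on K \<subseteq> \<Union>C" using pe(1) C(1) unfolding partial_embedding_def by blast
      show "b = \<zero>" if "(\<zero>, b) \<in> \<Union>C" for b using that partial_embeddingD(4)[OF pe(1)] by blast
      show "(\<ominus> a, \<ominus> b) \<in> \<Union>C" if "(a, b) \<in> \<Union>C" for a b
        using that partial_embeddingD(5)[OF pe(1)] by blast
      fix a b c d assume "(a, b) \<in> \<Union>C \<and> (c, d) \<in> \<Union>C"
      then obtain t where t: "t \<in> C" "(a, b) \<in> t" "(c, d) \<in> t" using two by blast
      show "(a \<oplus> c, b \<oplus> d) \<in> \<Union>C" "(a \<otimes> c, b \<otimes> d) \<in> \<Union>C"
        using partial_embeddingD(6,7)[OF pe(1)[OF t(1)] t(2,3)] t(1) by blast+
    qed
    then show "\<Union>C \<in> ?A" using pe(2) C(1) by blast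
  qed
  then obtain t where t: "partial_embedding K t" "r \<subseteq> t"
    and max: "\<forall>u\<in>?A. t \<subseteq> u \<longrightarrow> u = t"
    by blast
  have "z \<in> Domain t" if z: "z \<in> carrier R" for z
  proof -
    obtain u where u: "partial_embedding K u" "t \<subseteq> u" "z \<in> Domain u"
      using partial_embedding_extend[OF K n t(1) z] by blast
    then have "u \<in> ?A" using t(2) by simp
    then show ?thesis using max u(2,3) by blast
  qed
  moreover have "Domain t \<subseteq> carrier R" by (auto dest: partial_embeddingD(1)[OF t(1)])
  ultimately show ?thesis using that[OF t] by blast
qed

section \<open>Automorphisms from total embeddings\<close>

lemma galois_group_carrier:
  "carrier (galois_group R K) = {\<tau> \<in> Bij (carrier R). \<tau> \<in> ring_iso R R \<and> (\<forall>x \<in> K. \<tau> x = x)}"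
  unfolding galois_group_def by simp

lemma total_partial_embedding_galois:
  assumes K: "subfield K R" and n: "normal_over K" and t: "partial_embedding K t"
    and total: "Domain t = carrier R"
  obtains \<tau> where "\<tau> \<in> carrier (galois_group R K)" "\<And>a b. (a, b) \<in> t \<Longrightarrow> \<tau> a = b"
proof -
  have alg: "\<forall>x \<in> carrier R. (algebraic over K) x"
    using n unfolding normal_over_def by blast
  obtain s where "subfield (Domain t) R" "K \<subseteq> Domain t"
    and s: "ring_hom_ring (R\<lparr>carrier := Domain t\<rparr>) R s"
    and rs: "\<And>a b. (a, b) \<in> t \<longleftrightarrow> a \<in> Domain t \<and> b = s a" and sK: "\<And>k. k \<in> K \<Longrightarrow> s k = k"
    by (rule partial_embedding_obtain_hom[OF K t alg]; rule that; assumption)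
  interpret s: ring_hom_ring R R s using s total by simp
  have inj: "inj_on s (carrier R)"
    using s.img_is_subfield(1)[OF carrier_is_subfield] by simp
  \<comment> \<open>\<open>s\<close> permutes the finitely many roots of the minimal polynomial of \<open>y\<close>.\<close>
  have "y \<in> s ` carrier R" if y: "y \<in> carrier R" for y
  proof -
    note I = IrrE[OF K y bspec[OF alg y]]
    let ?S = "{x. is_root (Irr K y) x}"
    have set: "set (Irr K y) \<subseteq> K"
      using I(1) polynomial_incl unfolding univ_poly_carrier[symmetric] by blast
    then have map: "map s (Irr K y) = Irr K y" using sK by (intro map_idI) blast
    have "finite ?S"
      using finite_number_of_roots[OF carrier_polynomial_shell[OF subfieldE(1)[OF K] I(1)]] .
    moreover have "s ` ?S \<subseteq> ?S"
    proof safe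
      fix x assume x: "is_root (Irr K y) x"
      then have "s (eval (Irr K y) x) = eval (map s (Irr K y)) (s x)"
        using set subfieldE(3)[OF K] by (intro s.eval_hom') (auto simp: is_root_def)
      then show "is_root (Irr K y) (s x)"
        using x map by (simp add: is_root_def)
    qed
    moreover have "inj_on s ?S"
      using inj by (rule inj_on_subset) (auto simp: is_root_def)
    ultimately have "s ` ?S = ?S" by (simp add: endo_inj_surj)
    moreover have "y \<in> ?S"
      using I(4) y pirreducibleE(1)[OF subfieldE(1)[OF K] I(1,2)] by (simp add: is_root_def)
    ultimately show ?thesis unfolding is_root_def by blast
  qed
  then have bij: "bij_betw s (carrier R) (carrier R)"
    using inj s.hom_closed by (auto simp: bij_betw_def)
  \<comment> \<open>Members of \<open>Bij\<close> are extensional, so \<open>s\<close> has to be cut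
    down to the carrier.\<close>
  define \<tau> where "\<tau> = restrict s (carrier R)"
  have "\<tau> \<in> Bij (carrier R)"
    unfolding Bij_def \<tau>_def using bij by (simp cong: bij_betw_cong)
  moreover have "\<tau> \<in> ring_hom R R"
    unfolding \<tau>_def by (rule ring_hom_memI) auto
  moreover have "\<tau> k = k" if "k \<in> K" for k
    using sK[OF that] that subfieldE(3)[OF K] by (auto simp: \<tau>_def)
  ultimately have "\<tau> \<in> carrier (galois_group R K)"
    unfolding galois_group_carrier ring_iso_def Bij_def by blast
  moreover have "\<tau> a = b" if "(a, b) \<in> t" for a b
    using that rs total by (simp add: \<tau>_def)
  ultimately show ?thesis using that by blast
qed

text \<open>A polynomial over \<open>K\<close> vanishing at \<open>x\<close> is a multiple of
  \<open>Irr K x\<close>, so it vanishes at \<open>y\<close>. Hence \<open>x \<mapsto> y\<close>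
  defines an embedding of \<open>K(x)\<close> over \<open>K\<close>, and a total extension of it is
  an automorphism.\<close>

lemma galois_transitive:
  assumes K: "subfield K R" and n: "normal_over K" and xy: "x \<in> carrier R" "y \<in> carrier R"
    and root: "eval (Irr K x) y = \<zero>"
  obtains \<tau> where "\<tau> \<in> carrier (galois_group R K)" "\<tau> x = y"
proof -
  have alg: "(algebraic over K) x" using n xy unfolding normal_over_def by blast
  note I = IrrE[OF K xy(1) alg]
  have hom: "ring_hom_ring (R\<lparr>carrier := K\<rparr>) R id"
    using subring_is_ring[OF subfieldE(1)[OF K]] ring_axioms subfieldE(3)[OF K]
    by (intro ring_hom_ringI) auto
  have ker: "eval (map id p) y = \<zero>" if p: "p \<in> carrier (K[X])" "eval p x = \<zero>" for p
  proof -
    have "Irr K x divides\<^bsub>K[X]\<^esub> p"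
      using Irr_minimal[OF K xy(1) alg p] pdivides_iff_shell[OF K I(1) p(1)] by blast
    then obtain q where q: "q \<in> carrier (K[X])" "p = Irr K x \<otimes>\<^bsub>K[X]\<^esub> q"
      unfolding factor_def by blast
    note e = ring_hom_memE[OF eval_is_hom[OF subfieldE(1)[OF K] xy(2)]]
    show ?thesis using e(1)[OF q(1)] e(2)[OF I(1) q(1)] q(2) root by simp
  qed
  let ?r = "(\<lambda>p. (eval p x, eval (map id p) y)) ` carrier (K[X])"
  have A: "partial_embedding K ?r" "(x, y) \<in> ?r"
    by (rule partial_embedding_adjoin[OF K hom subset_refl id_apply xy ker]; assumption)+
  obtain t where t: "partial_embedding K t" "?r \<subseteq> t" "Domain t = carrier R"
    using partial_embedding_total[OF K n A(1)] .
  obtain \<tau> where "\<tau> \<in> carrier (galois_group R K)" "\<And>a b. (a, b) \<in> t \<Longrightarrow> \<tau> a = b"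
    by (rule total_partial_embedding_galois[OF K n t(1,3)]; rule that; assumption)
  then show ?thesis using that subsetD[OF t(2) A(2)] by blast
qed

end

section \<open>Galois groups and the degree of an extension\<close>

lemma (in group) lcoset_eq_iff:
  assumes "subgroup H G" "a \<in> carrier G" "b \<in> carrier G"
  shows "a <# H = b <# H \<longleftrightarrow> inv a \<otimes> b \<in> H"
proof
  interpret H: subgroup H G by fact
  show "inv a \<otimes> b \<in> H" if "a <# H = b <# H"
    using H.lcos_module_imp[OF group_axioms assms(2), of b] lcos_self[OF assms(3,1)] that by simp
  assume ab: "inv a \<otimes> b \<in> H"
  have "b = a \<otimes> (inv a \<otimes> b)" using assms by (simp add: m_assoc[symmetric])
  then have "b \<in> a <# H" using ab by (auto simp: l_coset_def)
  then show "a <# H = b <# H" using l_repr_independence[OF _ assms(2,1)] by blast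
qed

text \<open>Both images are the quotient of \<open>A\<close> by the same equivalence
  relation.\<close>

lemma card_image_eq_card_image:
  assumes "\<And>a b. a \<in> A \<Longrightarrow> b \<in> A \<Longrightarrow> f a = f b \<longleftrightarrow> g a = g b"
  shows "card (f ` A) = card (g ` A)"
proof (rule bij_betw_same_card)
  have f: "f (inv_into A f (f a)) = f a" "inv_into A f (f a) \<in> A" if "a \<in> A" for a
    using that by (auto intro: f_inv_into_f inv_into_into)
  then have "g (inv_into A f (f a)) = g a" if "a \<in> A" for a
    using that assms by blast
  then have "(\<lambda>y. g (inv_into A f y)) (f a) = g a" if "a \<in> A" for a
    using that by blast
  then show "bij_betw (\<lambda>y. g (inv_into A f y)) (f ` A) (g ` A)"
    unfolding bij_betw_def inj_on_def using assms by (auto simp: image_iff)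
qed

context field
begin

section \<open>The Galois group as a group of permutations\<close>

lemma galois_groupD:
  assumes "t \<in> carrier (galois_group R K)"
  shows "t \<in> Bij (carrier R)" "ring_hom_ring R R t" "\<And>x. x \<in> K \<Longrightarrow> t x = x"
    "inj_on t (carrier R)" "\<And>x. x \<in> carrier R \<Longrightarrow> t x \<in> carrier R"
  using assms ring_hom_ringI2[OF ring_axioms ring_axioms]
  unfolding galois_group_carrier ring_iso_def Bij_def bij_betw_def by auto

lemma galois_group_mult:
  assumes "s \<in> carrier (galois_group R K)" "t \<in> carrier (galois_group R K)"
  shows "s \<otimes>\<^bsub>galois_group R K\<^esub> t = compose (carrier R) s t"
  using galois_groupD(1)[OF assms(1)] galois_groupD(1)[OF assms(2)]
  unfolding galois_group_def BijGroup_def by simp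

lemma galois_subgroup:
  assumes "K \<subseteq> carrier R"
  shows "subgroup (carrier (galois_group R K)) (BijGroup (carrier R))"
proof -
  interpret B: group "BijGroup (carrier R)" by (rule group_BijGroup)
  show ?thesis
  proof (rule B.subgroupI)
    show "carrier (galois_group R K) \<subseteq> carrier (BijGroup (carrier R))"
      unfolding galois_group_carrier BijGroup_def by auto
    have "(\<lambda>x\<in>carrier R. x) \<in> carrier (galois_group R K)"
      unfolding galois_group_carrier ring_iso_def using assms
      by (auto simp: id_Bij intro!: ring_hom_memI) (simp add: bij_betw_def inj_on_def)
    then show "carrier (galois_group R K) \<noteq> {}" by blast
    fix s assume s: "s \<in> carrier (galois_group R K)"
    note S = galois_groupD[OF s]
    interpret s: ring_hom_ring R R s by (rule S(2))
    have img: "s ` carrier R = carrier R"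
      using S(1) unfolding Bij_def bij_betw_def by blast
    let ?i = "inv\<^bsub>BijGroup (carrier R)\<^esub> s"
    have i: "?i = (\<lambda>x\<in>carrier R. inv_into (carrier R) s x)"
      using inv_BijGroup[OF S(1)] .
    have ib: "?i \<in> Bij (carrier R)" unfolding i by (rule restrict_inv_into_Bij[OF S(1)])
    have is_: "?i (s x) = x" if "x \<in> carrier R" for x
      using that S(4) by (simp add: i)
    have sur: "\<exists>x. x \<in> carrier R \<and> y = s x" if "y \<in> carrier R" for y
      using that img by blast
    have "?i \<in> ring_hom R R"
    proof (rule ring_hom_memI)
      show "?i x \<in> carrier R" if "x \<in> carrier R" for x
        using sur[OF that] is_ by auto
      show "?i \<one> = \<one>" using is_[OF one_closed] by simp
      fix x y assume xy: "x \<in> carrier R" "y \<in> carrier R"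
      then obtain a b where ab: "a \<in> carrier R" "x = s a" "b \<in> carrier R" "y = s b"
        using sur by meson
      show "?i (x \<otimes> y) = ?i x \<otimes> ?i y"
        using is_[OF m_closed[OF ab(1,3)]] is_[OF ab(1)] is_[OF ab(3)] ab by simp
      show "?i (x \<oplus> y) = ?i x \<oplus> ?i y"
        using is_[OF a_closed[OF ab(1,3)]] is_[OF ab(1)] is_[OF ab(3)] ab by simp
    qed
    moreover have "?i x = x" if "x \<in> K" for x
      using is_[of x] S(3)[OF that] that assms by auto
    ultimately show "?i \<in> carrier (galois_group R K)"
      using ib unfolding galois_group_carrier ring_iso_def Bij_def by simp
    fix t assume t: "t \<in> carrier (galois_group R K)"
    note T = galois_groupD[OF t]
    interpret t: ring_hom_ring R R t by (rule T(2))
    have st: "s \<otimes>\<^bsub>BijGroup (carrier R)\<^esub> t = compose (carrier R) s t"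
      using S(1) T(1) unfolding BijGroup_def by simp
    have b: "compose (carrier R) s t \<in> Bij (carrier R)"
      using compose_Bij[OF S(1) T(1)] .
    have "compose (carrier R) s t \<in> ring_hom R R"
      by (rule ring_hom_memI) (simp_all add: compose_def)
    moreover have "compose (carrier R) s t x = x" if "x \<in> K" for x
      using S(3) T(3) that assms by (auto simp: compose_def)
    ultimately show "s \<otimes>\<^bsub>BijGroup (carrier R)\<^esub> t \<in> carrier (galois_group R K)"
      using b unfolding galois_group_carrier ring_iso_def Bij_def st by simp
  qed
qed

lemma galois_group_eq:
  "galois_group R K = BijGroup (carrier R)\<lparr>carrier := carrier (galois_group R K)\<rparr>"
  by (simp add: galois_group_def)

lemma group_galois_group:
  assumes "K \<subseteq> carrier R"
  shows "group (galois_group R K)"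
  by (subst galois_group_eq)
    (rule group.subgroup_imp_group[OF group_BijGroup galois_subgroup[OF assms]])

lemma galois_group_mono:
  assumes "K \<subseteq> L"
  shows "carrier (galois_group R L) \<subseteq> carrier (galois_group R K)"
  using assms unfolding galois_group_carrier by blast

lemma subgroup_galois_group:
  assumes "K \<subseteq> L" "L \<subseteq> carrier R"
  shows "subgroup (carrier (galois_group R L)) (galois_group R K)"
proof -
  have K: "K \<subseteq> carrier R" using assms by blast
  show ?thesis
    using group.subgroup_incl[OF group_BijGroup galois_subgroup[OF assms(2)] galois_subgroup[OF K]
        galois_group_mono[OF assms(1)]]
    by (subst galois_group_eq)
qed

lemma galois_group_inv:
  assumes "K \<subseteq> carrier R" "t \<in> carrier (galois_group R K)" "x \<in> carrier R"
  shows "(inv\<^bsub>galois_group R K\<^esub> t) (t x) = x"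
proof -
  interpret G: group "galois_group R K" by (rule group_galois_group[OF assms(1)])
  have "inv\<^bsub>galois_group R K\<^esub> t \<otimes>\<^bsub>galois_group R K\<^esub> t = \<one>\<^bsub>galois_group R K\<^esub>"
    using assms(2) by simp
  then have "compose (carrier R) (inv\<^bsub>galois_group R K\<^esub> t) t = (\<lambda>x\<in>carrier R. x)"
    using assms(2) by (simp add: galois_group_mult) (simp add: galois_group_def BijGroup_def)
  then show ?thesis using assms(3) by (metis compose_eq restrict_apply')
qed

text \<open>Two automorphisms agree on \<open>L\<close> exactly when
  \<open>inv a \<otimes> b\<close> fixes \<open>L\<close> pointwise, that is, when they define the
  same left coset. The index thus becomes a number of restrictions to \<open>L\<close>, which can be
  counted along a tower.\<close>

lemma card_lcosets_galois_group:
  assumes KL: "K \<subseteq> L" "L \<subseteq> carrier R"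
  shows "card (lcosets\<^bsub>galois_group R K\<^esub> carrier (galois_group R L)) =
         card ((\<lambda>t. restrict t L) ` carrier (galois_group R K))"
proof -
  have Kc: "K \<subseteq> carrier R" using KL by blast
  let ?G = "galois_group R K" and ?H = "carrier (galois_group R L)"
  interpret G: group ?G by (rule group_galois_group[OF Kc])
  have "a <#\<^bsub>?G\<^esub> ?H = b <#\<^bsub>?G\<^esub> ?H \<longleftrightarrow> restrict a L = restrict b L"
    if a: "a \<in> carrier ?G" and b: "b \<in> carrier ?G" for a b
  proof -
    let ?c = "inv\<^bsub>?G\<^esub> a \<otimes>\<^bsub>?G\<^esub> b"
    have c: "?c \<in> carrier ?G" using a b by simp
    have cx: "?c x = (inv\<^bsub>?G\<^esub> a) (b x)" if "x \<in> L" for x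
      using that KL a b by (auto simp: galois_group_mult compose_def)
    have "?c \<in> ?H \<longleftrightarrow> (\<forall>x\<in>L. ?c x = x)"
      using c unfolding galois_group_carrier by blast
    also have "\<dots> \<longleftrightarrow> (\<forall>x\<in>L. b x = a x)"
    proof (rule ball_cong[OF refl])
      fix x assume x: "x \<in> L"
      then have xc: "x \<in> carrier R" using KL by blast
      have ia: "inv\<^bsub>?G\<^esub> a \<in> carrier ?G" using a by simp
      have "(inv\<^bsub>?G\<^esub> a) (b x) = x \<longleftrightarrow> (inv\<^bsub>?G\<^esub> a) (b x) = (inv\<^bsub>?G\<^esub> a) (a x)"
        using galois_group_inv[OF Kc a xc] by simp
      also have "\<dots> \<longleftrightarrow> b x = a x"
        using inj_on_eq_iff[OF galois_groupD(4)[OF ia]] galois_groupD(5)[OF a xc]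
          galois_groupD(5)[OF b xc] by blast
      finally show "?c x = x \<longleftrightarrow> b x = a x" using cx[OF x] by simp
    qed
    also have "\<dots> \<longleftrightarrow> restrict a L = restrict b L"
      by (auto simp: restrict_def fun_eq_iff)
    finally show ?thesis
      using G.lcoset_eq_iff[OF subgroup_galois_group[OF KL] a b] by blast
  qed
  then have "card ((\<lambda>a. a <#\<^bsub>?G\<^esub> ?H) ` carrier ?G) = card ((\<lambda>t. restrict t L) ` carrier ?G)"
    by (rule card_image_eq_card_image)
  moreover have "lcosets\<^bsub>?G\<^esub> ?H = (\<lambda>a. a <#\<^bsub>?G\<^esub> ?H) ` carrier ?G"
    unfolding LCOSETS_def by blast
  ultimately show ?thesis by simp
qed

section \<open>Minimal polynomials in towers and the number of restrictions\<close>

lemma univ_poly_mono: "K \<subseteq> M \<Longrightarrow> p \<in> carrier (K[X]) \<Longrightarrow> p \<in> carrier (M[X])"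
  unfolding univ_poly_carrier[symmetric] polynomial_def by blast

lemma Irr_tower:
  assumes K: "subfield K R" and M: "subfield M R" and KM: "K \<subseteq> M"
    and x: "x \<in> carrier R" and alg: "(algebraic over K) x"
  shows "(algebraic over M) x" "Irr M x \<in> carrier (poly_ring R)" "Irr K x \<in> carrier (poly_ring R)"
    "Irr M x \<noteq> []" "Irr K x \<noteq> []" "Irr M x pdivides Irr K x"
proof -
  show algM: "(algebraic over M) x" using algebraic_mono[OF KM alg] .
  note I = IrrE[OF M x algM] and J = IrrE[OF K x alg]
  show "Irr M x \<in> carrier (poly_ring R)" "Irr K x \<in> carrier (poly_ring R)"
    using carrier_polynomial_shell[OF subfieldE(1)[OF M] I(1)]
      carrier_polynomial_shell[OF subfieldE(1)[OF K] J(1)] by blast+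
  show "Irr M x \<noteq> []" "Irr K x \<noteq> []"
    using pirreducibleE(1)[OF subfieldE(1)[OF M] I(1,2)]
      pirreducibleE(1)[OF subfieldE(1)[OF K] J(1,2)] by blast+
  show "Irr M x pdivides Irr K x"
    using Irr_minimal[OF M x algM univ_poly_mono[OF KM J(1)] J(4)] .
qed

lemma normal_over_mono:
  assumes K: "subfield K R" and M: "subfield M R" and KM: "K \<subseteq> M" and n: "normal_over K"
  shows "normal_over M"
  unfolding normal_over_def
proof
  fix x assume x: "x \<in> carrier R"
  then have a: "(algebraic over K) x" and s: "splitted (Irr K x)"
    using n unfolding normal_over_def by blast+
  note T = Irr_tower[OF K M KM x a]
  show "(algebraic over M) x \<and> splitted (Irr M x)"
    using T(1) pdivides_imp_splitted[OF T(2,3,5) s T(6)] by blast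
qed

text \<open>The multiset of roots of \<open>Irr M x\<close> is contained in that of
  \<open>Irr K x\<close>, where multiplicities are at most 1, and its size is the degree because
  \<open>Irr M x\<close> splits. Separability is assumed over \<open>K\<close> so that one
  hypothesis serves every \<open>M\<close> of the tower.\<close>

lemma card_roots_Irr:
  assumes K: "subfield K R" and M: "subfield M R" and KM: "K \<subseteq> M" and n: "normal_over K"
    and x: "x \<in> carrier R" and sep: "\<forall>a \<in> carrier R. alg_mult (Irr K x) a \<le> 1"
  shows "card {y \<in> carrier R. eval (Irr M x) y = \<zero>} = degree (Irr M x)"
proof -
  have a: "(algebraic over K) x" using n x unfolding normal_over_def by blast
  note T = Irr_tower[OF K M KM x a]
  have root: "y \<in># roots (Irr M x) \<longleftrightarrow> y \<in> carrier R \<and> eval (Irr M x) y = \<zero>" for y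
    using roots_mem_iff_is_root[OF T(2)] T(4) by (simp add: is_root_def)
  have "count (roots (Irr M x)) y = 1" if y: "y \<in># roots (Irr M x)" for y
  proof -
    have "count (roots (Irr M x)) y \<le> count (roots (Irr K x)) y"
      using pdivides_imp_roots_incl[OF T(2,3,5,6)] by (simp add: subseteq_mset_def)
    also have "\<dots> \<le> 1"
      using sep root[of y] y alg_mult_eq_count_roots[OF T(3)] by metis
    finally show ?thesis using y count_greater_zero_iff[of "roots (Irr M x)" y] by linarith
  qed
  then have "size (roots (Irr M x)) = card (set_mset (roots (Irr M x)))"
    unfolding size_multiset_overloaded_eq by simp
  moreover have "set_mset (roots (Irr M x)) = {y \<in> carrier R. eval (Irr M x) y = \<zero>}"
    using root by blast
  moreover have "size (roots (Irr M x)) = degree (Irr M x)"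
    using normal_over_mono[OF K M KM n] x unfolding normal_over_def splitted_def by blast
  ultimately show ?thesis by simp
qed

lemma galois_fixes_simple_extension:
  assumes M: "subfield M R" and x: "x \<in> carrier R"
    and t: "t \<in> carrier (galois_group R M)" and tx: "t x = x"
  shows "t \<in> carrier (galois_group R (simple_extension M x))"
proof -
  interpret t: ring_hom_ring R R t by (rule galois_groupD(2)[OF t])
  have "t y = y" if y: "y \<in> simple_extension M x" for y
  proof -
    obtain p where p: "p \<in> carrier (M[X])" "y = eval p x"
      using y unfolding simple_extension_as_eval_img[OF subfieldE(3)[OF M] x] by blast
    have set: "set p \<subseteq> M" using p(1) polynomial_incl unfolding univ_poly_carrier[symmetric] by blast
    then have "map t p = p" using galois_groupD(3)[OF t] by (intro map_idI) blast
    then show ?thesis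
      using t.eval_hom'[OF x, of p] set subfieldE(3)[OF M] tx p(2) by auto
  qed
  then show ?thesis using t unfolding galois_group_carrier by blast
qed

lemma galois_root:
  assumes M: "subfield M R" and x: "x \<in> carrier R" and alg: "(algebraic over M) x"
    and t: "t \<in> carrier (galois_group R M)"
  shows "eval (Irr M x) (t x) = \<zero>"
proof -
  interpret t: ring_hom_ring R R t by (rule galois_groupD(2)[OF t])
  note I = IrrE[OF M x alg]
  have set: "set (Irr M x) \<subseteq> M"
    using I(1) polynomial_incl unfolding univ_poly_carrier[symmetric] by blast
  then have "map t (Irr M x) = Irr M x" using galois_groupD(3)[OF t] by (intro map_idI) blast
  then show ?thesis
    using t.eval_hom'[OF x, of "Irr M x"] set subfieldE(3)[OF M] I(4) by simp
qed

text \<open>A finite family spanning \<open>L\<close> over \<open>M\<close> also spans it over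
  \<open>M'\<close>.\<close>

lemma finite_dimension_intermediate:
  assumes M: "subfield M R" and M': "subfield M' R" and L: "subring L R"
    and MM': "M \<subseteq> M'" and M'L: "M' \<subseteq> L" and d: "dimension d M L"
  obtains m where "dimension m M' L"
proof -
  obtain Us where Us: "set Us \<subseteq> carrier R" "Span M Us = L"
    using exists_base[OF M d] by blast
  note L' = subringE[OF L]
  have UL: "set Us \<subseteq> L" using Span_base_incl[OF M Us(1)] Us(2) by blast
  have "Span M' Us \<subseteq> L"
  proof (rule Span_min[OF M' Us(1)])
    show "subgroup L (add_monoid R)" using L unfolding subring_def by blast
    show "M' <#> set Us \<subseteq> L" using L'(6) M'L UL unfolding set_mult_def by blast
  qed
  moreover have "L \<subseteq> Span M' Us"
  proof -
    have "Span M Us = {combine Ks Us | Ks. set Ks \<subseteq> M}" "Span M' Us = {combine Ks Us | Ks. set Ks \<subseteq> M'}"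
      using Span_eq_combine_set[OF M Us(1)] Span_eq_combine_set[OF M' Us(1)] by auto
    then show ?thesis using Us(2) MM' by blast
  qed
  ultimately have "Span M' Us = L" by blast
  then show ?thesis
    using Span_finite_dimension[OF M' Us(1)] that unfolding finite_dimension_def by auto
qed

text \<open>Induction on the degree of \<open>L\<close> over \<open>M\<close>, with \<open>M\<close>
  growing towards the fixed field \<open>L\<close>. Adjoining \<open>x\<close> from \<open>L\<close>
  factors the degree as \<open>?e * m\<close>. Correspondingly there are \<open>?e\<close> possible
  images of \<open>x\<close>, the roots of \<open>Irr M x\<close>, and for each of them as many
  restrictions as there are over \<open>M(x)\<close>.\<close>

lemma card_restrictions:
  assumes K: "subfield K R" and L: "subfield L R" and n: "normal_over K"
    and sep: "\<And>x. x \<in> L \<Longrightarrow> \<forall>a \<in> carrier R. alg_mult (Irr K x) a \<le> 1"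
  shows "subfield M R \<Longrightarrow> K \<subseteq> M \<Longrightarrow> M \<subseteq> L \<Longrightarrow> dimension d M L \<Longrightarrow>
    card ((\<lambda>t. restrict t L) ` carrier (galois_group R M)) = d"
proof (induction d arbitrary: M rule: less_induct)
  case (less d)
  note M = less.prems(1) and KM = less.prems(2) and sub = less.prems(3)
  have Lc: "L \<subseteq> carrier R" and Mc: "M \<subseteq> carrier R" using subfieldE(3) L M by blast+
  interpret G: group "galois_group R M" by (rule group_galois_group[OF Mc])
  show ?case
  proof (cases "L \<subseteq> M")
    case True
    then have LM: "L = M" using sub by blast
    have "d = 1"
      using dimension_is_inj[OF M less.prems(4)] dimension_one[OF M] LM by blast
    have "restrict t L = restrict id L" if "t \<in> carrier (galois_group R M)" for t
      using galois_groupD(3)[OF that] LM by (auto simp: restrict_def fun_eq_iff)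
    moreover have "carrier (galois_group R M) \<noteq> {}" using G.one_closed by blast
    ultimately have img: "(\<lambda>t. restrict t L) ` carrier (galois_group R M) = {restrict id L}" by auto
    show ?thesis unfolding img \<open>d = 1\<close> by simp
  next
    case False
    then obtain x where xL: "x \<in> L" and xM: "x \<notin> M" by blast
    then have x: "x \<in> carrier R" using Lc by blast
    have nM: "normal_over M" using normal_over_mono[OF K M KM n] .
    then have alg: "(algebraic over M) x" using x unfolding normal_over_def by blast
    note I = IrrE[OF M x alg]
    let ?M' = "simple_extension M x" and ?e = "degree (Irr M x)"
    have M': "subfield ?M' R" using simple_extension_is_subfield[OF M x] alg by blast
    have MM': "M \<subseteq> ?M'" using simple_extension_incl[OF Mc x] .
    have xM': "x \<in> ?M'" using simple_extension_mem[OF subfieldE(1)[OF M] x] .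
    have M'L: "?M' \<subseteq> L" using simple_extension_subring_incl[OF subfieldE(1)[OF L] sub xL] .
    have dime: "dimension ?e M ?M'" using dimension_simple_extension[OF M x alg] .
    obtain m where m: "dimension m ?M' L"
      using finite_dimension_intermediate[OF M M' subfieldE(1)[OF L] MM' M'L less.prems(4)] .
    have d: "d = ?e * m"
      using dimension_is_inj[OF M less.prems(4) telescopic_base[OF M M' dime m]] .
    have "d \<noteq> 0"
    proof
      assume "d = 0"
      then have "L = {\<zero>}" using dimension_zero[OF M] less.prems(4) by simp
      then show False using subringE(3)[OF subfieldE(1)[OF L]] by simp
    qed
    \<comment> \<open>A linear minimal polynomial would put \<open>x\<close> into \<open>M\<close>.
      As \<open>d = ?e * m\<close> is nonzero, this makes \<open>m\<close> smaller than
      \<open>d\<close>.\<close>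
    have "?e \<noteq> 1"
    proof
      assume "?e = 1"
      then obtain a b where ab: "a \<in> M" "b \<in> M" "Irr M x = [a, b]"
        using degree_oneE[OF I(1)] by metis
      then have "Irr M x = [\<one>, b]" using I(3) by simp
      then have "x \<oplus> b = \<zero>" using I(4) x ab(2) Mc by auto
      then have "x = \<ominus> b" using x ab(2) Mc by (metis minus_equality subsetD)
      then show False using xM subringE(5)[OF subfieldE(1)[OF M] ab(2)] by simp
    qed
    then have "m < d" using d \<open>d \<noteq> 0\<close> by (cases "?e") auto
    have KM': "K \<subseteq> ?M'" using KM MM' by blast
    have IH: "card ((\<lambda>t. restrict t L) ` carrier (galois_group R ?M')) = m"
      using less.IH[OF \<open>m < d\<close> M' KM' M'L m] .
    let ?S = "{y \<in> carrier R. eval (Irr M x) y = \<zero>}"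
    let ?B = "\<lambda>M. (\<lambda>t. restrict t L) ` carrier (galois_group R M)"
    have "\<exists>t. t \<in> carrier (galois_group R M) \<and> t x = y" if y: "y \<in> ?S" for y
      using galois_transitive[OF M nM x, of y] y by blast
    note ex = this
    define T where "T y = (SOME t. t \<in> carrier (galois_group R M) \<and> t x = y)" for y
    have T: "T y \<in> carrier (galois_group R M)" "T y x = y" if "y \<in> ?S" for y
      using someI_ex[OF ex[OF that]] unfolding T_def by blast+
    \<comment> \<open>An automorphism over \<open>M\<close> is the chosen one with the same value at \<open>x\<close>, composed with one over \<open>M(x)\<close>.\<close>
    define F where "F = (\<lambda>(y, g). \<lambda>l\<in>L. T y (g l) :: 'a)"
    have "bij_betw F (?S \<times> ?B ?M') (?B M)"
      unfolding bij_betw_def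
    proof
      show "inj_on F (?S \<times> ?B ?M')"
      proof (rule inj_onI, clarify)
        fix y s y' s'
        assume y: "y \<in> carrier R" "eval (Irr M x) y = \<zero>" and y': "y' \<in> carrier R" "eval (Irr M x) y' = \<zero>"
          and s: "s \<in> carrier (galois_group R ?M')" and s': "s' \<in> carrier (galois_group R ?M')"
          and eq: "F (y, restrict s L) = F (y', restrict s' L)"
        have yS: "y \<in> ?S" "y' \<in> ?S" using y y' by blast+
        have E: "T y (s l) = T y' (s' l)" if "l \<in> L" for l
          using fun_cong[OF eq, of l] that by (simp add: F_def)
        \<comment> \<open>Automorphisms over \<open>?M'\<close> fix \<open>x\<close>, so evaluating
          at \<open>x\<close> recovers the root.\<close>
        have yy: "y = y'"
          using E[OF xL] galois_groupD(3)[OF s xM'] galois_groupD(3)[OF s' xM'] T(2) yS by simp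
        have "s l = s' l" if l: "l \<in> L" for l
        proof -
          have lc: "l \<in> carrier R" using l Lc by blast
          show ?thesis
            using E[OF l] yy inj_on_eq_iff[OF galois_groupD(4)[OF T(1)[OF yS(1)]]
              galois_groupD(5)[OF s lc] galois_groupD(5)[OF s' lc]] by blast
        qed
        then show "y = y' \<and> restrict s L = restrict s' L"
          using yy by (auto simp: restrict_def fun_eq_iff)
      qed
      show "F ` (?S \<times> ?B ?M') = ?B M"
      proof
        show "F ` (?S \<times> ?B ?M') \<subseteq> ?B M"
        proof clarify
          fix y s
          assume y: "y \<in> carrier R" "eval (Irr M x) y = \<zero>" and s: "s \<in> carrier (galois_group R ?M')"
          have yS: "y \<in> ?S" using y by blast
          have sM: "s \<in> carrier (galois_group R M)" using s galois_group_mono[OF MM'] by blast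
          have "F (y, restrict s L) = restrict (T y \<otimes>\<^bsub>galois_group R M\<^esub> s) L"
            unfolding galois_group_mult[OF T(1)[OF yS] sM] F_def
            using Lc by (auto simp: fun_eq_iff restrict_def compose_def)
          then show "F (y, restrict s L) \<in> ?B M"
            using G.m_closed[OF T(1)[OF yS] sM] by blast
        qed
        show "?B M \<subseteq> F ` (?S \<times> ?B ?M')"
        proof clarify
          fix t assume t: "t \<in> carrier (galois_group R M)"
          let ?y = "t x"
          have yS: "?y \<in> ?S" using galois_root[OF M x alg t] galois_groupD(5)[OF t x] by blast
          \<comment> \<open>Undoing the chosen automorphism with the same value at \<open>x\<close>
            leaves one that fixes \<open>x\<close>, hence all of \<open>?M'\<close>.\<close>
          let ?s = "inv\<^bsub>galois_group R M\<^esub> (T ?y) \<otimes>\<^bsub>galois_group R M\<^esub> t"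
          have iT: "inv\<^bsub>galois_group R M\<^esub> (T ?y) \<in> carrier (galois_group R M)"
            using G.inv_closed[OF T(1)[OF yS]] .
          have sM: "?s \<in> carrier (galois_group R M)" using G.m_closed[OF iT t] .
          have "?s x = x"
            using galois_group_inv[OF Mc T(1)[OF yS] x] T(2)[OF yS] x
            unfolding galois_group_mult[OF iT t] by (simp add: compose_def)
          then have s: "?s \<in> carrier (galois_group R ?M')"
            using galois_fixes_simple_extension[OF M x sM] by blast
          have "T ?y \<otimes>\<^bsub>galois_group R M\<^esub> ?s = t"
            using G.inv_solve_left[OF sM T(1)[OF yS] t] by simp
          then have "compose (carrier R) (T ?y) ?s = t"
            unfolding galois_group_mult[OF T(1)[OF yS] sM] .
          then have "T ?y (?s l) = t l" if "l \<in> L" for l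
            using that Lc by (metis compose_eq subsetD)
          then have "restrict t L = F (?y, restrict ?s L)"
            unfolding F_def by (auto simp: fun_eq_iff restrict_def)
          then show "restrict t L \<in> F ` (?S \<times> ?B ?M')"
            using yS s by blast
        qed
      qed
    qed
    then have "card (?B M) = card (?S \<times> ?B ?M')" by (rule bij_betw_same_card[symmetric])
    also have "\<dots> = ?e * m"
      using card_roots_Irr[OF K M KM n x sep[OF xL]] IH by (simp add: card_cartesian_product)
    finally show ?thesis unfolding d .
  qed
qed

text \<open>\<open>Irr K x\<close> is irreducible with root \<open>x\<close>, so
  \<open>normal_extension\<close> makes it split; this is the form of normality used for the
  count.\<close>

lemma card_lcosets_galois_eq_dimension:
  assumes K: "subfield K R" and L: "subfield L R" and KL: "K \<subseteq> L" and d: "dimension d K L"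
    and n: "normal_extension K R" and sep: "separable_extension R K L"
  shows "card (lcosets\<^bsub>galois_group R K\<^esub> carrier (galois_group R L)) = d"
proof -
  have "splitted (Irr K x)" if x: "x \<in> carrier R" for x
  proof -
    have alg: "(algebraic over K) x" using n x unfolding normal_extension_def over_def by blast
    note I = IrrE[OF K x alg]
    show ?thesis using n I(1,2,4) x unfolding normal_extension_def by blast
  qed
  then have "normal_over K"
    using n unfolding normal_over_def normal_extension_def over_def by blast
  then have "card ((\<lambda>t. restrict t L) ` carrier (galois_group R K)) = d"
    using sep unfolding separable_extension_def
    by (intro card_restrictions[OF K L _ _ K subset_refl KL d]) blast+
  then show ?thesis using card_lcosets_galois_group[OF KL subfieldE(3)[OF L]] by simp
qed

end

section \<open>Geometric sums modulo a prime power\<close>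

text \<open>The value at \<open>0\<close> of the \<open>k\<close>-th iterate of
  \<open>i \<mapsto> a * i + 1\<close>.\<close>

definition geom_sum :: "int \<Rightarrow> nat \<Rightarrow> int" where
  "geom_sum a k = (\<Sum>i<k. a ^ i)"

lemma geom_sum_0 [simp]: "geom_sum a 0 = 0" and geom_sum_1 [simp]: "geom_sum a (Suc 0) = 1"
  and geom_sum_Suc: "geom_sum a (Suc k) = a * geom_sum a k + 1"
  by (simp_all add: geom_sum_def sum.lessThan_Suc_shift sum_distrib_left del: sum.lessThan_Suc)

lemma geom_sum_2: "geom_sum a 2 = 1 + a"
  by (simp add: geom_sum_def numeral_2_eq_2)

lemma geom_sum_add: "geom_sum a (k + l) = geom_sum a k + a ^ k * geom_sum a l"
  by (induction k) (simp_all add: geom_sum_Suc algebra_simps)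

lemma geom_sum_mult: "geom_sum a (k * l) = geom_sum a k * geom_sum (a ^ k) l"
  by (induction l) (simp_all add: geom_sum_Suc geom_sum_add algebra_simps)

lemma geom_sum_cong:
  assumes "[a = 1] (mod q)"
  shows "[geom_sum a k = int k] (mod q)"
proof (induction k)
  case (Suc k)
  have "[a * geom_sum a k + 1 = 1 * int k + 1] (mod q)"
    using assms Suc by (intro cong_add cong_mult) auto
  then show ?case by (simp add: geom_sum_Suc algebra_simps)
qed simp

text \<open>Write \<open>b = 1 + p t\<close> and expand modulo \<open>p^2\<close>: the sum is
  \<open>p + p t (0 + 1 + ... + (p - 1))\<close>. For odd \<open>p\<close> the inner sum is a
  multiple of \<open>p\<close>, so only \<open>p\<close> remains. For \<open>p = 2\<close>,
  \<open>b = 3\<close> the sum is 4, so oddness is essential.\<close>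

lemma geom_sum_prime:
  fixes p :: nat
  assumes "odd p" "[b = 1] (mod int p)"
  obtains s where "geom_sum b p = int p * (1 + int p * s)"
proof -
  obtain t where b: "b = 1 + int p * t"
    using assms(2) by (metis cong_iff_lin cong_sym)
  \<comment> \<open>The binomial expansion of \<open>b ^ k\<close>, with everything beyond first
    order in \<open>p\<close> collected in \<open>s\<close>.\<close>
  have pow: "\<exists>s. b ^ k = 1 + int p * (t * int k) + int p ^ 2 * s" for k
  proof (induction k)
    case (Suc k)
    then obtain s where "b ^ k = 1 + int p * (t * int k) + int p ^ 2 * s" by blast
    then have "b ^ Suc k = 1 + int p * (t * int (Suc k)) + int p ^ 2 * (s * b + t * t * int k)"
      by (simp add: b algebra_simps power2_eq_square)
    then show ?case by blast
  qed simp
  have geom_sum: "\<exists>s. geom_sum b k = int k + int p * (t * int (\<Sum>i<k. i)) + int p ^ 2 * s" for k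
  proof (induction k)
    case (Suc k)
    then obtain s where "geom_sum b k = int k + int p * (t * int (\<Sum>i<k. i)) + int p ^ 2 * s" by blast
    moreover obtain s' where "b ^ k = 1 + int p * (t * int k) + int p ^ 2 * s'" using pow by blast
    moreover have "geom_sum b (Suc k) = geom_sum b k + b ^ k" by (simp add: geom_sum_def)
    ultimately have "geom_sum b (Suc k) =
      int (Suc k) + int p * (t * int (\<Sum>i<Suc k. i)) + int p ^ 2 * (s + s')"
      by (simp add: algebra_simps)
    then show ?case by blast
  qed simp
  obtain q where p: "p = 2 * q + 1" using assms(1) by (metis oddE)
  \<comment> \<open>At \<open>k = p = 2 * q + 1\<close> this gives \<open>p * q\<close>, the factor
    \<open>p\<close> that moves the linear term into order \<open>p^2\<close>.\<close>
  have "2 * (\<Sum>i<k. i) = k * (k - 1)" for k :: nat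
    by (induction k) (auto simp: algebra_simps diff_mult_distrib)
  from this[of p] have "(\<Sum>i<p. i) = p * q" by (simp add: p)
  then obtain s where "geom_sum b p = int p + int p * (t * int (p * q)) + int p ^ 2 * s"
    using geom_sum[of p] by metis
  then have "geom_sum b p = int p * (1 + int p * (t * int q + s))"
    by (simp add: algebra_simps power2_eq_square)
  then show ?thesis using that by blast
qed

lemma coprime_cong_1:
  fixes p :: nat
  assumes "[a = 1] (mod int p)"
  shows "coprime a (int p ^ n)"
proof -
  have "coprime a (int p)" using cong_imp_coprime[OF cong_sym[OF assms]] by simp
  then show ?thesis by simp
qed

text \<open>\<open>geom_sum a k\<close> and \<open>k\<close> contain the same power of
  \<open>p\<close>. Each factor \<open>p\<close> of \<open>k = l * p\<close> splits off
  \<open>geom_sum (a ^ l) p\<close>, which is \<open>p\<close> times a number congruent to 1 modulo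
  \<open>p\<close>. If \<open>p\<close> does not divide \<open>k\<close>, it divides
  neither.\<close>

lemma geom_sum_dvd_iff:
  fixes p :: nat
  assumes p: "Factorial_Ring.prime p" "odd p" and a: "[a = 1] (mod int p)"
  shows "int p ^ n dvd geom_sum a k \<longleftrightarrow> int p ^ n dvd int k"
  using a
proof (induction n arbitrary: a k)
  case (Suc n)
  have dvd: "int p dvd geom_sum a k \<longleftrightarrow> int p dvd int k"
    using geom_sum_cong[OF Suc.prems] by (rule cong_dvd_iff)
  show ?case
  proof (cases "p dvd k")
    case False
    then have "\<not> int p dvd geom_sum a k" "\<not> int p dvd int k" using dvd by simp_all
    then show ?thesis by (metis dvd_mult_left power_Suc)
  next
    case True
    then obtain l where k: "k = l * p" by (metis dvd_def mult.commute)
    have "[a ^ l = 1] (mod int p)" using cong_pow[OF Suc.prems, of l] by simp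
    then obtain s where s: "geom_sum (a ^ l) p = int p * (1 + int p * s)"
      using geom_sum_prime[OF p(2)] by blast
    have cop: "coprime (int p ^ n) (1 + int p * s)"
      using coprime_cong_1[of "1 + int p * s" p n] by (simp add: cong_iff_dvd_diff coprime_commute)
    have p0: "int p \<noteq> 0" using p(1) by (simp add: prime_gt_0_nat)
    have "int p ^ Suc n dvd geom_sum a k \<longleftrightarrow> int p * int p ^ n dvd int p * (geom_sum a l * (1 + int p * s))"
      by (simp add: k geom_sum_mult s algebra_simps)
    also have "\<dots> \<longleftrightarrow> int p ^ n dvd geom_sum a l * (1 + int p * s)"
      using p0 by (simp only: dvd_mult_cancel_left) simp
    also have "\<dots> \<longleftrightarrow> int p ^ n dvd geom_sum a l"
      using cop by (simp add: coprime_dvd_mult_left_iff)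
    also have "\<dots> \<longleftrightarrow> int p ^ n dvd int l" using Suc by blast
    also have "\<dots> \<longleftrightarrow> int p * int p ^ n dvd int p * int l"
      using p0 by (simp only: dvd_mult_cancel_left) simp
    also have "\<dots> \<longleftrightarrow> int p ^ Suc n dvd int k" by (simp add: k algebra_simps)
    finally show ?thesis .
  qed
qed simp

text \<open>\<open>geom_sum a (k + l) - geom_sum a k\<close> is \<open>geom_sum a l\<close> times
  the unit \<open>a ^ k\<close>, so the divisibility criterion applies to differences.\<close>

lemma geom_sum_cong_iff:
  fixes p :: nat
  assumes p: "Factorial_Ring.prime p" "odd p" and a: "[a = 1] (mod int p)"
  shows "[geom_sum a k = geom_sum a l] (mod int p ^ n) \<longleftrightarrow> [int k = int l] (mod int p ^ n)"
proof -
  have le: "[geom_sum a (k + l) = geom_sum a k] (mod int p ^ n) \<longleftrightarrow> [int (k + l) = int k] (mod int p ^ n)" for k l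
  proof -
    have "coprime (int p ^ n) (a ^ k)"
      using coprime_cong_1[OF a, of n] by (auto simp: coprime_commute)
    then have "[geom_sum a (k + l) = geom_sum a k] (mod int p ^ n) \<longleftrightarrow> int p ^ n dvd geom_sum a l"
      by (simp add: cong_iff_dvd_diff geom_sum_add coprime_dvd_mult_right_iff)
    then show ?thesis
      by (simp add: geom_sum_dvd_iff[OF p a] cong_iff_dvd_diff)
  qed
  show ?thesis
  proof (cases "k \<le> l")
    case True
    then show ?thesis using le[of k "l - k"] by (simp add: cong_sym_eq)
  next
    case False
    then show ?thesis using le[of l "k - l"] by simp
  qed
qed

text \<open>In \<open>a ^ t - 1 = (a - 1) * geom_sum a t\<close> the second factor is congruent to
  \<open>t\<close> modulo \<open>p\<close>, hence a unit.\<close>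

lemma cong_1_of_power:
  fixes p :: nat
  assumes p: "Factorial_Ring.prime p" and a: "[a = 1] (mod int p)"
    and t: "\<not> p dvd t" and pow: "[a ^ t = 1] (mod int p ^ n)"
  shows "[a = 1] (mod int p ^ n)"
proof -
  have "\<not> int p dvd geom_sum a t" using cong_dvd_iff[OF geom_sum_cong[OF a, of t]] t by simp
  then have "coprime (int p ^ n) (geom_sum a t)"
    using p by (simp add: prime_imp_coprime)
  moreover have "a ^ t - 1 = (a - 1) * geom_sum a t" by (simp add: power_diff_1_eq geom_sum_def)
  ultimately show ?thesis
    using pow by (simp add: cong_iff_dvd_diff coprime_dvd_mult_left_iff)
qed

text \<open>The first \<open>p ^ n\<close> sums are pairwise incongruent, so they exhaust the
  residues.\<close>

lemma geom_sum_surj: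
  fixes p :: nat
  assumes p: "Factorial_Ring.prime p" "odd p" and a: "[a = 1] (mod int p)"
  obtains k where "[geom_sum a k = i] (mod int p ^ n)"
proof -
  have pos: "int p ^ n > 0" using prime_gt_0_nat[OF p(1)] by simp
  let ?f = "\<lambda>k. geom_sum a k mod int p ^ n"
  have "inj_on ?f {..<p ^ n}"
  proof (rule inj_onI)
    fix k l assume "k \<in> {..<p ^ n}" "l \<in> {..<p ^ n}" "?f k = ?f l"
    then show "k = l"
      using geom_sum_cong_iff[OF p a, of k l n] by (simp add: cong_def flip: of_nat_power zmod_int)
  qed
  then have "card (?f ` {..<p ^ n}) = card {0..<int p ^ n}"
    by (simp add: card_image flip: of_nat_power)
  moreover have "?f ` {..<p ^ n} \<subseteq> {0..<int p ^ n}" using pos by auto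
  ultimately have "?f ` {..<p ^ n} = {0..<int p ^ n}" by (intro card_subset_eq) auto
  then have "i mod int p ^ n \<in> ?f ` {..<p ^ n}" using pos by simp
  then show ?thesis using that by (auto simp: cong_def)
qed

text \<open>These residues are \<open>1 + p t\<close> with \<open>t\<close> below
  \<open>p ^ (n - 1)\<close>.\<close>

lemma card_cong_1:
  fixes p :: nat
  assumes p: "Factorial_Ring.prime p" and n: "n \<ge> 1"
  shows "card {a \<in> {0..<int p ^ n}. [a = 1] (mod int p)} = p ^ (n - 1)"
proof -
  have p1: "int p > 1" using prime_gt_1_nat[OF p] by simp
  have pn: "int p ^ n = int p * int p ^ (n - 1)" using n by (metis power_eq_if not_one_le_zero)
  have "{a \<in> {0..<int p ^ n}. [a = 1] (mod int p)} = (\<lambda>t. 1 + int p * t) ` {0..<int p ^ (n - 1)}"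
  proof (intro equalityI subsetI)
    fix a assume a: "a \<in> {a \<in> {0..<int p ^ n}. [a = 1] (mod int p)}"
    then have "a mod int p = 1" using p1 by (simp add: cong_def)
    then have eq: "a = 1 + int p * (a div int p)" using mult_div_mod_eq[of "int p" a] by linarith
    have "int p * (a div int p) < int p * int p ^ (n - 1)" using a eq pn by simp
    then have "a div int p < int p ^ (n - 1)" using p1 by simp
    then have "a div int p \<in> {0..<int p ^ (n - 1)}" using a p1 by (simp add: pos_imp_zdiv_nonneg_iff)
    then show "a \<in> (\<lambda>t. 1 + int p * t) ` {0..<int p ^ (n - 1)}" using eq by (rule image_eqI[rotated])
  next
    fix a assume "a \<in> (\<lambda>t. 1 + int p * t) ` {0..<int p ^ (n - 1)}"
    then obtain t where "a = 1 + int p * t" "t \<in> {0..<int p ^ (n - 1)}" by blast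
    then have t: "a = 1 + int p * t" "0 \<le> t" "t + 1 \<le> int p ^ (n - 1)" by auto
    have "int p * (t + 1) \<le> int p ^ n" unfolding pn using t(3) p1 by (intro mult_left_mono) auto
    moreover have "a < int p * (t + 1)" using t p1 by (simp add: algebra_simps)
    ultimately have "a < int p ^ n" by linarith
    then show "a \<in> {a \<in> {0..<int p ^ n}. [a = 1] (mod int p)}"
      using t p1 by (simp add: cong_def)
  qed
  moreover have "inj_on (\<lambda>t. 1 + int p * t) {0..<int p ^ (n - 1)}"
    using p1 by (auto simp: inj_on_def)
  ultimately show ?thesis by (simp add: card_image flip: of_nat_power)
qed

section \<open>Regular cyclic permutation groups\<close>

text \<open>A labelling of \<open>\<Omega>\<close> by the integers modulo \<open>m\<close>.\<close>

definition coordinate :: "nat \<Rightarrow> 'x set \<Rightarrow> (int \<Rightarrow> 'x) \<Rightarrow> bool" where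
  "coordinate m \<Omega> h \<longleftrightarrow> (\<forall>i j. h i = h j \<longleftrightarrow> [i = j] (mod int m)) \<and> range h = \<Omega>"

text \<open>Translation by \<open>j\<close> in the labelling \<open>h\<close>. All labels of a point
  are congruent, so it does not matter which one \<open>SOME\<close> picks; the restriction to
  \<open>\<Omega>\<close> makes it an element of \<open>Bij\<close>.\<close>

definition shift :: "'x set \<Rightarrow> (int \<Rightarrow> 'x) \<Rightarrow> int \<Rightarrow> 'x \<Rightarrow> 'x" where
  "shift \<Omega> h j = (\<lambda>x\<in>\<Omega>. h ((SOME i. h i = x) + j))"

section \<open>Translations in a labelling\<close>

lemma coordinate_eq_iff: "coordinate m \<Omega> h \<Longrightarrow> h i = h j \<longleftrightarrow> [i = j] (mod int m)"
  and coordinate_mem: "coordinate m \<Omega> h \<Longrightarrow> h i \<in> \<Omega>"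
  unfolding coordinate_def by blast+

lemma coordinateE:
  assumes "coordinate m \<Omega> h" "x \<in> \<Omega>"
  obtains i where "x = h i"
  using assms unfolding coordinate_def by blast

lemma coordinate_nat:
  assumes "coordinate m \<Omega> h" "m > 0" "x \<in> \<Omega>"
  obtains k :: nat where "x = h (int k)"
proof -
  obtain i where "x = h i" using coordinateE[OF assms(1,3)] .
  then have "x = h (int (nat (i mod int m)))"
    using assms(2) coordinate_eq_iff[OF assms(1)] by (simp add: cong_def)
  then show ?thesis using that by blast
qed

lemma shift_apply:
  assumes "coordinate m \<Omega> h"
  shows "shift \<Omega> h j (h i) = h (i + j)"
proof -
  have "h (SOME k. h k = h i) = h i" by (rule someI) (rule refl)
  then have "[(SOME k. h k = h i) + j = i + j] (mod int m)"
    using coordinate_eq_iff[OF assms] by (intro cong_add) auto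
  then show ?thesis
    using coordinate_eq_iff[OF assms] coordinate_mem[OF assms] unfolding shift_def by simp
qed

lemma extensional_eqI:
  assumes "coordinate m \<Omega> h" "f \<in> extensional \<Omega>" "g \<in> extensional \<Omega>" "\<And>i. f (h i) = g (h i)"
  shows "f = g"
proof (rule extensionalityI[OF assms(2,3)])
  fix x assume "x \<in> \<Omega>"
  then obtain i where "x = h i" using coordinateE[OF assms(1)] by blast
  then show "f x = g x" using assms(4) by simp
qed

lemma shift_extensional: "shift \<Omega> h j \<in> extensional \<Omega>"
  unfolding shift_def by simp

lemma shift_Bij:
  assumes "coordinate m \<Omega> h"
  shows "shift \<Omega> h j \<in> Bij \<Omega>"
proof -
  note s = shift_apply[OF assms] and c = coordinate_eq_iff[OF assms]
  have "inj_on (shift \<Omega> h j) \<Omega>"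
  proof (rule inj_onI)
    fix x y assume "x \<in> \<Omega>" "y \<in> \<Omega>" and eq: "shift \<Omega> h j x = shift \<Omega> h j y"
    then obtain i k where ik: "x = h i" "y = h k" using coordinateE[OF assms] by metis
    then have "h (i + j) = h (k + j)" using eq s by simp
    then show "x = y" using c ik by (simp add: cong_add_rcancel)
  qed
  moreover have "shift \<Omega> h j ` \<Omega> = \<Omega>"
  proof (intro equalityI subsetI)
    fix x assume "x \<in> shift \<Omega> h j ` \<Omega>"
    then obtain y where "y \<in> \<Omega>" "x = shift \<Omega> h j y" by blast
    moreover from this obtain i where "y = h i" using coordinateE[OF assms] by blast
    ultimately show "x \<in> \<Omega>" using s coordinate_mem[OF assms] by simp
  next
    fix x assume "x \<in> \<Omega>"
    then obtain i where "x = h i" using coordinateE[OF assms] by blast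
    then have "x = shift \<Omega> h j (h (i - j))" using s by simp
    then show "x \<in> shift \<Omega> h j ` \<Omega>" using coordinate_mem[OF assms] by blast
  qed
  ultimately show ?thesis using shift_extensional unfolding Bij_def bij_betw_def by blast
qed

lemma shift_mult:
  assumes "coordinate m \<Omega> h"
  shows "shift \<Omega> h i \<otimes>\<^bsub>BijGroup \<Omega>\<^esub> shift \<Omega> h j = shift \<Omega> h (i + j)"
proof -
  have "compose \<Omega> (shift \<Omega> h i) (shift \<Omega> h j) = shift \<Omega> h (i + j)"
  proof (rule extensional_eqI[OF assms _ shift_extensional])
    show "compose \<Omega> (shift \<Omega> h i) (shift \<Omega> h j) (h k) = shift \<Omega> h (i + j) (h k)" for k
      using coordinate_mem[OF assms] by (simp add: compose_def shift_apply[OF assms] algebra_simps)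
  qed simp
  then show ?thesis using shift_Bij[OF assms] by (simp add: BijGroup_def)
qed

lemma shift_eq_iff:
  assumes "coordinate m \<Omega> h"
  shows "shift \<Omega> h i = shift \<Omega> h j \<longleftrightarrow> [i = j] (mod int m)"
proof
  assume "shift \<Omega> h i = shift \<Omega> h j"
  then have "h (0 + i) = h (0 + j)" using shift_apply[OF assms] by metis
  then show "[i = j] (mod int m)" using coordinate_eq_iff[OF assms] by simp
next
  assume ij: "[i = j] (mod int m)"
  show "shift \<Omega> h i = shift \<Omega> h j"
  proof (rule extensional_eqI[OF assms shift_extensional shift_extensional])
    show "shift \<Omega> h i (h k) = shift \<Omega> h j (h k)" for k
      using ij by (simp add: shift_apply[OF assms] coordinate_eq_iff[OF assms] cong_add_lcancel)
  qed
qed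

lemma range_shift_subset_Bij: "coordinate m \<Omega> h \<Longrightarrow> range (shift \<Omega> h) \<subseteq> Bij \<Omega>"
  using shift_Bij by blast

lemma regular_subgroup_range_shift:
  assumes "coordinate m \<Omega> h"
  shows "regular_subgroup (range (shift \<Omega> h)) \<Omega>"
  unfolding regular_subgroup_def
proof (intro conjI ballI)
  interpret B: group "BijGroup \<Omega>" by (rule group_BijGroup)
  have carrier: "carrier (BijGroup \<Omega>) = Bij \<Omega>" by (simp add: BijGroup_def)
  have zero: "shift \<Omega> h 0 = \<one>\<^bsub>BijGroup \<Omega>\<^esub>"
    using shift_mult[OF assms, of 0 0] shift_Bij[OF assms, of 0] carrier B.l_cancel_one by simp
  show "subgroup (range (shift \<Omega> h)) (BijGroup \<Omega>)"
  proof (rule B.subgroupI)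
    show "range (shift \<Omega> h) \<subseteq> carrier (BijGroup \<Omega>)"
      using range_shift_subset_Bij[OF assms] carrier by simp
    fix a b assume "a \<in> range (shift \<Omega> h)"
    then obtain i where a: "a = shift \<Omega> h i" by blast
    have "shift \<Omega> h (- i) \<otimes>\<^bsub>BijGroup \<Omega>\<^esub> shift \<Omega> h i = \<one>\<^bsub>BijGroup \<Omega>\<^esub>"
      using shift_mult[OF assms, of "- i" i] zero by simp
    then have "inv\<^bsub>BijGroup \<Omega>\<^esub> a = shift \<Omega> h (- i)"
      unfolding a using shift_Bij[OF assms] carrier by (intro B.inv_equality) simp_all
    then show "inv\<^bsub>BijGroup \<Omega>\<^esub> a \<in> range (shift \<Omega> h)" by blast
    assume "b \<in> range (shift \<Omega> h)"
    then obtain j where b: "b = shift \<Omega> h j" by blast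
    show "a \<otimes>\<^bsub>BijGroup \<Omega>\<^esub> b \<in> range (shift \<Omega> h)" unfolding a b shift_mult[OF assms] by blast
  qed simp
  fix x y assume "x \<in> \<Omega>" "y \<in> \<Omega>"
  then obtain i j where ij: "x = h i" "y = h j" using coordinateE[OF assms] by metis
  show "\<exists>!\<eta>. \<eta> \<in> range (shift \<Omega> h) \<and> \<eta> x = y"
  proof (rule ex1I[of _ "shift \<Omega> h (j - i)"])
    show "shift \<Omega> h (j - i) \<in> range (shift \<Omega> h) \<and> shift \<Omega> h (j - i) x = y"
      using ij shift_apply[OF assms] by simp
    fix \<eta> assume "\<eta> \<in> range (shift \<Omega> h) \<and> \<eta> x = y"
    then obtain k where k: "\<eta> = shift \<Omega> h k" "\<eta> x = y" by blast
    then have "[i + k = i + (j - i)] (mod int m)"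
      using ij shift_apply[OF assms] coordinate_eq_iff[OF assms] by simp
    then show "\<eta> = shift \<Omega> h (j - i)"
      using k(1) shift_eq_iff[OF assms] by (simp only: cong_add_lcancel)
  qed
qed

lemma range_shift_iso:
  assumes "coordinate m \<Omega> h" "m > 0"
  shows "BijGroup \<Omega> \<lparr>carrier := range (shift \<Omega> h)\<rparr> \<cong> integer_mod_group m"
proof -
  let ?N = "BijGroup \<Omega> \<lparr>carrier := range (shift \<Omega> h)\<rparr>"
  have "group ?N"
    using regular_subgroup_range_shift[OF assms(1)] unfolding regular_subgroup_def
    by (blast intro: group.subgroup_imp_group[OF group_BijGroup])
  moreover have "shift \<Omega> h \<in> iso (integer_mod_group m) ?N"
  proof (rule isoI)
    show "shift \<Omega> h \<in> hom (integer_mod_group m) ?N"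
      using assms by (intro homI) (auto simp: shift_mult[OF assms(1)] shift_eq_iff[OF assms(1)] cong_def)
    show "bij_betw (shift \<Omega> h) (carrier (integer_mod_group m)) (carrier ?N)"
      unfolding bij_betw_def
    proof
      show "inj_on (shift \<Omega> h) (carrier (integer_mod_group m))"
        using assms(2) by (auto simp: inj_on_def shift_eq_iff[OF assms(1)] cong_def carrier_integer_mod_group)
      have "shift \<Omega> h i \<in> shift \<Omega> h ` carrier (integer_mod_group m)" for i
        using assms(2) by (intro image_eqI[where x = "i mod int m"])
          (simp_all add: shift_eq_iff[OF assms(1)] carrier_integer_mod_group)
      then show "shift \<Omega> h ` carrier (integer_mod_group m) = carrier ?N" by auto
    qed
  qed
  then have "integer_mod_group m \<cong> ?N" unfolding is_iso_def by blast
  then show ?thesis by (rule group.iso_sym[OF group_integer_mod_group])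
qed

text \<open>Number the elements of \<open>N\<close> by an isomorphism with the integers modulo
  \<open>m\<close> and give the point \<open>g i \<omega>\<close> the label \<open>i\<close>.
  Regularity makes this a labelling, and then \<open>g j\<close> is translation by
  \<open>j\<close>.\<close>

lemma regular_cyclic_obtain_coordinate:
  assumes reg: "regular_subgroup N \<Omega>" and m: "m > 0" and \<omega>: "\<omega> \<in> \<Omega>"
    and iso: "BijGroup \<Omega> \<lparr>carrier := N\<rparr> \<cong> integer_mod_group m"
  obtains h where "coordinate m \<Omega> h" "N = range (shift \<Omega> h)" "h 0 = \<omega>"
proof -
  let ?N = "BijGroup \<Omega> \<lparr>carrier := N\<rparr>"
  have sub: "subgroup N (BijGroup \<Omega>)"
    and ex1: "\<And>x y. x \<in> \<Omega> \<Longrightarrow> y \<in> \<Omega> \<Longrightarrow> \<exists>!\<eta>. \<eta> \<in> N \<and> \<eta> x = y"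
    using reg unfolding regular_subgroup_def by blast+
  have NB: "N \<subseteq> Bij \<Omega>" using subgroup.subset[OF sub] by (simp add: BijGroup_def)
  have gN: "group ?N" using group.subgroup_imp_group[OF group_BijGroup sub] .
  obtain f where f: "f \<in> hom (integer_mod_group m) ?N"
    "bij_betw f (carrier (integer_mod_group m)) N"
    using group.iso_sym[OF gN iso] unfolding is_iso_def iso_def by auto
  have mod: "i mod int m \<in> carrier (integer_mod_group m)" for i
    using m by (simp add: carrier_integer_mod_group)
  \<comment> \<open>The isomorphism lives on the residues \<open>0..m-1\<close>; its periodic
    extension turns composition into addition of integers.\<close>
  define g where "g i = f (i mod int m)" for i
  have gN: "g i \<in> N" for i
    unfolding g_def using bij_betwE[OF f(2)] mod by blast
  have gmult: "compose \<Omega> (g i) (g j) = g (i + j)" for i j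
  proof -
    have "g (i + j) = g i \<otimes>\<^bsub>?N\<^esub> g j"
      using hom_mult[OF f(1) mod[of i] mod[of j]] by (simp add: g_def mod_add_eq)
    then show ?thesis using gN NB by (simp add: BijGroup_def subset_iff)
  qed
  have geq: "g i = g j \<longleftrightarrow> [i = j] (mod int m)" for i j
    unfolding g_def cong_def using inj_on_eq_iff[OF bij_betw_imp_inj_on[OF f(2)] mod mod] .
  have Ng: "N = range g"
  proof (intro equalityI subsetI)
    fix \<eta> assume "\<eta> \<in> N"
    then obtain i where i: "i \<in> carrier (integer_mod_group m)" "\<eta> = f i"
      using f(2) unfolding bij_betw_def by blast
    then have "i mod int m = i" using m by (simp add: carrier_integer_mod_group)
    then have "\<eta> = g i" using i(2) by (simp add: g_def)
    then show "\<eta> \<in> range g" by blast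
  qed (use gN in blast)
  define h where "h i = g i \<omega>" for i
  have hm: "h i \<in> \<Omega>" for i
    unfolding h_def using gN NB \<omega> Bij_imp_funcset by blast
  have gh: "g j (h i) = h (i + j)" for i j
    unfolding h_def using gmult[of j i] \<omega> by (metis add.commute compose_eq)
  have coord: "coordinate m \<Omega> h"
    unfolding coordinate_def
  proof (intro conjI allI)
    show "h i = h j \<longleftrightarrow> [i = j] (mod int m)" for i j
      unfolding geq[symmetric] using ex1[OF \<omega> hm[of j]] gN unfolding h_def by metis
    have "y \<in> range h" if y: "y \<in> \<Omega>" for y
    proof -
      obtain \<eta> where "\<eta> \<in> N" "\<eta> \<omega> = y" using ex1[OF \<omega> y] by blast
      then show ?thesis unfolding Ng h_def by blast
    qed
    then show "range h = \<Omega>" using hm by blast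
  qed
  have "g j = shift \<Omega> h j" for j
  proof (rule extensional_eqI[OF coord _ shift_extensional])
    show "g j \<in> extensional \<Omega>" using gN NB Bij_imp_extensional by blast
    show "g j (h i) = shift \<Omega> h j (h i)" for i
      using gh shift_apply[OF coord] by simp
  qed
  then have "N = range (shift \<Omega> h)" using Ng by (simp add: image_def)
  moreover have "h 0 = \<omega>"
  proof -
    obtain k where k: "\<omega> = h k" using coordinateE[OF coord \<omega>] .
    have "g 0 \<omega> = \<omega>" unfolding k using gh[of 0 k] by simp
    then show ?thesis by (simp add: h_def)
  qed
  ultimately show ?thesis using that[OF coord] by blast
qed

section \<open>Normalizing a group of translations\<close>

definition normalizes :: "'x set \<Rightarrow> ('x \<Rightarrow> 'x) \<Rightarrow> ('x \<Rightarrow> 'x) set \<Rightarrow> bool" where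
  "normalizes \<Omega> c N \<longleftrightarrow> (\<forall>\<eta>\<in>N. \<exists>\<eta>'\<in>N. \<forall>x\<in>\<Omega>. c (\<eta> x) = \<eta>' (c x))"

text \<open>Multiplying \<open>c \<eta> c^-1 = \<eta>'\<close> by \<open>c\<close> on the right
  removes the inverse, and what remains can be checked point by point.\<close>

lemma conj_mem_iff_normalizes:
  assumes c: "c \<in> Bij \<Omega>" and N: "N \<subseteq> Bij \<Omega>"
  shows "(\<forall>\<eta>\<in>N. c \<otimes>\<^bsub>BijGroup \<Omega>\<^esub> \<eta> \<otimes>\<^bsub>BijGroup \<Omega>\<^esub> inv\<^bsub>BijGroup \<Omega>\<^esub> c \<in> N) \<longleftrightarrow> normalizes \<Omega> c N"
proof -
  interpret B: group "BijGroup \<Omega>" by (rule group_BijGroup)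
  have car: "carrier (BijGroup \<Omega>) = Bij \<Omega>" by (simp add: BijGroup_def)
  have mult: "f \<otimes>\<^bsub>BijGroup \<Omega>\<^esub> g = compose \<Omega> f g" if "f \<in> Bij \<Omega>" "g \<in> Bij \<Omega>" for f g
    using that by (simp add: BijGroup_def)
  have "c \<otimes>\<^bsub>BijGroup \<Omega>\<^esub> \<eta> \<otimes>\<^bsub>BijGroup \<Omega>\<^esub> inv\<^bsub>BijGroup \<Omega>\<^esub> c \<in> N \<longleftrightarrow>
    (\<exists>\<eta>'\<in>N. \<forall>x\<in>\<Omega>. c (\<eta> x) = \<eta>' (c x))" if \<eta>: "\<eta> \<in> N" for \<eta>
  proof -
    have \<eta>B: "\<eta> \<in> Bij \<Omega>" using \<eta> N by blast
    have conj: "c \<otimes>\<^bsub>BijGroup \<Omega>\<^esub> \<eta> \<otimes>\<^bsub>BijGroup \<Omega>\<^esub> inv\<^bsub>BijGroup \<Omega>\<^esub> c = \<eta>' \<longleftrightarrow>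
      (\<forall>x\<in>\<Omega>. c (\<eta> x) = \<eta>' (c x))" if \<eta>': "\<eta>' \<in> N" for \<eta>'
    proof -
      have \<eta>'B: "\<eta>' \<in> Bij \<Omega>" using \<eta>' N by blast
      have "c \<otimes>\<^bsub>BijGroup \<Omega>\<^esub> \<eta> \<otimes>\<^bsub>BijGroup \<Omega>\<^esub> inv\<^bsub>BijGroup \<Omega>\<^esub> c = \<eta>' \<longleftrightarrow>
        c \<otimes>\<^bsub>BijGroup \<Omega>\<^esub> \<eta> = \<eta>' \<otimes>\<^bsub>BijGroup \<Omega>\<^esub> c"
        using B.inv_solve_right'[of "c \<otimes>\<^bsub>BijGroup \<Omega>\<^esub> \<eta>" c \<eta>'] B.inv_solve_right[of \<eta>' "c \<otimes>\<^bsub>BijGroup \<Omega>\<^esub> \<eta>" c]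
          c \<eta>B \<eta>'B car by auto
      also have "\<dots> \<longleftrightarrow> compose \<Omega> c \<eta> = compose \<Omega> \<eta>' c"
        using mult c \<eta>B \<eta>'B by simp
      also have "\<dots> \<longleftrightarrow> (\<forall>x\<in>\<Omega>. c (\<eta> x) = \<eta>' (c x))"
        by (auto simp: compose_def fun_eq_iff restrict_def)
      finally show ?thesis .
    qed
    then show ?thesis by blast
  qed
  then show ?thesis unfolding normalizes_def by blast
qed

text \<open>The labelling \<open>e\<close> follows a fixed cycle of length \<open>p ^ n\<close>,
  namely \<open>shift \<Omega> e 1\<close>; the regular subgroups to be counted come with other
  labellings \<open>h\<close> of the same points.\<close>

locale prime_power_cycle =
  fixes p n :: nat and \<Omega> :: "'x set" and e :: "int \<Rightarrow> 'x"
  assumes p: "Factorial_Ring.prime p" "odd p" and n: "n \<ge> 1"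
    and e: "coordinate (p ^ n) \<Omega> e"
begin

abbreviation m :: int where "m \<equiv> int p ^ n"

lemma m_pos: "p ^ n > 0" "m > 0" using prime_gt_0_nat[OF p(1)] by simp_all

lemma p_dvd_m: "int p dvd m" using n by (simp add: dvd_power)

lemma cong_p: "[i = j] (mod m) \<Longrightarrow> [i = j] (mod int p)"
  using p_dvd_m cong_dvd_modulus by blast

lemma coordinate_eq_iff_cong: "coordinate (p ^ n) \<Omega> h \<Longrightarrow> h i = h j \<longleftrightarrow> [i = j] (mod m)"
  using coordinate_eq_iff[of "p ^ n" \<Omega> h] by simp

text \<open>
  The labellings in which the cycle \<open>shift \<Omega> e 1\<close> becomes \<open>i \<mapsto> a i + 1\<close>: a cyclic regular
  group normalized by the cycle is the translation group of exactly one of them.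
\<close>

definition affine :: "int \<Rightarrow> (int \<Rightarrow> 'x) \<Rightarrow> bool" where
  "affine a h \<longleftrightarrow> coordinate (p ^ n) \<Omega> h \<and> h 0 = e 0 \<and> (\<forall>i. shift \<Omega> e 1 (h i) = h (a * i + 1))"

lemma affineD:
  assumes "affine a h"
  shows "coordinate (p ^ n) \<Omega> h" "h 0 = e 0" "\<And>i. shift \<Omega> e 1 (h i) = h (a * i + 1)"
  using assms unfolding affine_def by blast+

text \<open>Both sides are the \<open>k\<close>-th iterate of the cycle at the base point, read in
  the two labellings.\<close>

lemma affine_geo:
  assumes "affine a h"
  shows "e (int k) = h (geom_sum a k)"
proof (induction k)
  case (Suc k)
  have "e (int (Suc k)) = shift \<Omega> e 1 (e (int k))"
    by (simp add: shift_apply[OF e] add.commute)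
  then show ?case using Suc affineD(3)[OF assms] by (simp add: geom_sum_Suc)
qed (simp add: affineD(2)[OF assms])

text \<open>Every residue is a geometric sum, so \<open>affine_geo\<close> prescribes all values of
  \<open>h\<close>.\<close>

lemma affine_unique:
  assumes "affine a h" "affine a h'" "[a = 1] (mod int p)"
  shows "h = h'"
proof
  fix i
  obtain k where k: "[geom_sum a k = i] (mod m)" using geom_sum_surj[OF p assms(3)] .
  then have "h i = h (geom_sum a k)" "h' i = h' (geom_sum a k)"
    using coordinate_eq_iff_cong affineD(1)[OF assms(1)] affineD(1)[OF assms(2)] cong_sym by blast+
  then show "h i = h' i" using affine_geo[OF assms(1)] affine_geo[OF assms(2)] by metis
qed

text \<open>\<open>affine_geo\<close> is taken as the definition: the point \<open>e k\<close>
  receives the label \<open>geom_sum a k\<close>. This is a labelling because the sums permute the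
  residues.\<close>

lemma affine_exists:
  assumes a: "[a = 1] (mod int p)"
  obtains h where "affine a h"
proof -
  define k where "k i = (SOME k. [geom_sum a k = i] (mod m))" for i
  have k: "[geom_sum a (k i) = i] (mod m)" for i
    unfolding k_def by (rule someI_ex) (use geom_sum_surj[OF p a] in blast)
  define h where "h i = e (int (k i))" for i
  have hg: "h (geom_sum a l) = e (int l)" for l
    using k[of "geom_sum a l"] geom_sum_cong_iff[OF p a] coordinate_eq_iff_cong[OF e] by (simp add: h_def)
  have heq: "h i = h j \<longleftrightarrow> [i = j] (mod m)" for i j
  proof -
    have "h i = h j \<longleftrightarrow> [geom_sum a (k i) = geom_sum a (k j)] (mod m)"
      using geom_sum_cong_iff[OF p a] coordinate_eq_iff_cong[OF e] by (simp add: h_def)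
    then show ?thesis using k[of i] k[of j] by (metis cong_sym cong_trans)
  qed
  have "x \<in> range h" if "x \<in> \<Omega>" for x
    using coordinate_nat[OF e m_pos(1) that] hg by (metis rangeI)
  then have "range h = \<Omega>" using coordinate_mem[OF e] by (auto simp: h_def)
  then have coord: "coordinate (p ^ n) \<Omega> h" unfolding coordinate_def using heq by simp
  have "shift \<Omega> e 1 (h i) = h (a * i + 1)" for i
  proof -
    have "shift \<Omega> e 1 (h i) = e (int (Suc (k i)))"
      by (simp add: h_def shift_apply[OF e] add.commute)
    also have "\<dots> = h (a * geom_sum a (k i) + 1)" unfolding hg[symmetric] by (simp add: geom_sum_Suc)
    also have "\<dots> = h (a * i + 1)"
      unfolding heq using k by (intro cong_add cong_mult) auto
    finally show ?thesis .
  qed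
  moreover have "h 0 = e 0" using hg[of 0] by simp
  ultimately show ?thesis using that coord unfolding affine_def by blast
qed

text \<open>Conjugation by \<open>i \<mapsto> a * i + 1\<close> turns translation by
  \<open>j\<close> into translation by \<open>a * j\<close>; powers of the cycle follow by
  iteration.\<close>

lemma shift_normalizes:
  assumes "affine a h"
  shows "normalizes \<Omega> (shift \<Omega> e (int k)) (range (shift \<Omega> h))"
proof -
  note h = affineD[OF assms]
  have one: "\<exists>j'. \<forall>x\<in>\<Omega>. shift \<Omega> e 1 (shift \<Omega> h j x) = shift \<Omega> h j' (shift \<Omega> e 1 x)" for j
  proof (intro exI ballI)
    fix x assume "x \<in> \<Omega>"
    then obtain i where "x = h i" by (rule coordinateE[OF h(1)])
    then show "shift \<Omega> e 1 (shift \<Omega> h j x) = shift \<Omega> h (a * j) (shift \<Omega> e 1 x)"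
      by (simp add: h(3) shift_apply[OF h(1)] algebra_simps)
  qed
  have mem: "shift \<Omega> e i x \<in> \<Omega>" if "x \<in> \<Omega>" for x i
    using Bij_imp_funcset[OF shift_Bij[OF e]] that by blast
  have suc: "shift \<Omega> e (int (Suc k)) x = shift \<Omega> e 1 (shift \<Omega> e (int k) x)" if x: "x \<in> \<Omega>" for k x
  proof -
    obtain i where "x = e i" using coordinateE[OF e x] .
    then show ?thesis by (simp add: shift_apply[OF e] algebra_simps)
  qed
  have "\<exists>j'. \<forall>x\<in>\<Omega>. shift \<Omega> e (int k) (shift \<Omega> h j x) = shift \<Omega> h j' (shift \<Omega> e (int k) x)" for j
  proof (induction k)
    case 0
    have "shift \<Omega> e (int 0) x = x" if x: "x \<in> \<Omega>" for x
    proof -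
      obtain i where "x = e i" using coordinateE[OF e x] .
      then show ?thesis by (simp add: shift_apply[OF e])
    qed
    moreover have "shift \<Omega> h j x \<in> \<Omega>" if "x \<in> \<Omega>" for x
      using Bij_imp_funcset[OF shift_Bij[OF h(1)]] that by blast
    ultimately show ?case by (intro exI[of _ j]) simp
  next
    case (Suc k)
    then obtain j1 where j1: "\<forall>x\<in>\<Omega>. shift \<Omega> e (int k) (shift \<Omega> h j x) = shift \<Omega> h j1 (shift \<Omega> e (int k) x)"
      by blast
    obtain j2 where j2: "\<forall>x\<in>\<Omega>. shift \<Omega> e 1 (shift \<Omega> h j1 x) = shift \<Omega> h j2 (shift \<Omega> e 1 x)"
      using one by blast
    have hm: "shift \<Omega> h j x \<in> \<Omega>" if "x \<in> \<Omega>" for x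
      using Bij_imp_funcset[OF shift_Bij[OF h(1)]] that by blast
    show ?case
    proof (intro exI ballI)
      fix x assume x: "x \<in> \<Omega>"
      show "shift \<Omega> e (int (Suc k)) (shift \<Omega> h j x) = shift \<Omega> h j2 (shift \<Omega> e (int (Suc k)) x)"
        using j1 j2 mem[OF x] x suc[OF x] suc[OF hm[OF x]] by metis
    qed
  qed
  then show ?thesis unfolding normalizes_def by blast
qed

text \<open>The cycle conjugates translation by 1 into some translation by \<open>a\<close>, hence
  acts on labels as \<open>i \<mapsto> a * i + b\<close>. Transitivity excludes fixed points modulo
  \<open>p\<close>, which controls both \<open>a\<close> and \<open>b\<close>.\<close>

lemma normalized_obtain_affine:
  assumes h: "coordinate (p ^ n) \<Omega> h" "h 0 = e 0"
    and norm: "normalizes \<Omega> (shift \<Omega> e 1) (range (shift \<Omega> h))"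
  obtains a h' where "[a = 1] (mod int p)" "0 \<le> a" "a < m" "affine a h'"
    "range (shift \<Omega> h') = range (shift \<Omega> h)"
proof -
  let ?c = "shift \<Omega> e 1"
  have p1: "int p > 1" using prime_gt_1_nat[OF p(1)] by simp
  have pr: "Factorial_Ring.prime (int p)" using p(1) by simp
  have mem: "h i \<in> \<Omega>" for i using coordinate_mem[OF h(1)] .
  have cmem: "?c x \<in> \<Omega>" if "x \<in> \<Omega>" for x using Bij_imp_funcset[OF shift_Bij[OF e]] that by blast
  obtain a where a: "\<And>x. x \<in> \<Omega> \<Longrightarrow> ?c (shift \<Omega> h 1 x) = shift \<Omega> h a (?c x)"
    using norm unfolding normalizes_def by blast
  obtain b where b: "?c (h 0) = h b" using coordinateE[OF h(1) cmem[OF mem]] .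
  have nat: "?c (h (int i)) = h (a * int i + b)" for i
  proof (induction i)
    case (Suc i)
    have "?c (h (int (Suc i))) = ?c (shift \<Omega> h 1 (h (int i)))"
      by (simp add: shift_apply[OF h(1)] add.commute)
    also have "\<dots> = shift \<Omega> h a (h (a * int i + b))" using a[OF mem] Suc by simp
    also have "\<dots> = h (a * int (Suc i) + b)" by (simp add: shift_apply[OF h(1)] algebra_simps)
    finally show ?case .
  qed (simp add: b)
  have ch: "?c (h i) = h (a * i + b)" for i
  proof -
    obtain k where k: "h i = h (int k)" using coordinate_nat[OF h(1) m_pos(1) mem] .
    then have "[i = int k] (mod m)" using coordinate_eq_iff_cong[OF h(1)] by simp
    then have "[a * i + b = a * int k + b] (mod m)" by (intro cong_add cong_mult) auto
    then have "h (a * i + b) = h (a * int k + b)" using coordinate_eq_iff_cong[OF h(1)] by blast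
    then show ?thesis using k nat[of k] by simp
  qed
  \<comment> \<open>A fixed point modulo \<open>p\<close> would confine the whole orbit of the cycle to one residue class.\<close>
  have no_fixed: "\<not> int p dvd (a - 1) * i0 + b" for i0
  proof
    assume dvd: "int p dvd (a - 1) * i0 + b"
    obtain l where l: "h i0 = e l" using coordinateE[OF e mem] .
    have inv: "\<exists>j. e (l + int k) = h j \<and> [j = i0] (mod int p)" for k
    proof (induction k)
      case 0
      then show ?case using l by (intro exI[of _ i0]) simp
    next
      case (Suc k)
      then obtain j where j: "e (l + int k) = h j" "[j = i0] (mod int p)" by blast
      have "e (l + int (Suc k)) = ?c (e (l + int k))"
        by (simp add: shift_apply[OF e] algebra_simps)
      then have "e (l + int (Suc k)) = h (a * j + b)" using j(1) ch by simp
      moreover have "[a * j + b = a * i0 + b] (mod int p)"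
        using j(2) by (intro cong_add cong_mult) auto
      moreover have "[a * i0 + b = i0] (mod int p)"
        using dvd by (simp add: cong_iff_dvd_diff algebra_simps)
      ultimately show ?case using cong_trans by blast
    qed
    \<comment> \<open>By transitivity the cycle also carries \<open>h i0\<close> to the point
      labelled \<open>i0 + 1\<close>, which lies in a different class.\<close>
    obtain l' where l': "h (i0 + 1) = e l'" using coordinateE[OF e mem] .
    define k where "k = nat ((l' - l) mod m)"
    have "[l + int k = l'] (mod m)"
    proof -
      have "int k = (l' - l) mod m" unfolding k_def using m_pos(2) by simp
      then have "[int k = l' - l] (mod m)" by simp
      then have "[l + int k = l + (l' - l)] (mod m)" by (intro cong_add) auto
      then show ?thesis by simp
    qed
    then have "h (i0 + 1) = e (l + int k)" unfolding l' coordinate_eq_iff_cong[OF e] by (rule cong_sym)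
    then obtain j where "h (i0 + 1) = h j" "[j = i0] (mod int p)" using inv[of k] by metis
    then have "[i0 + 1 = i0] (mod int p)" using coordinate_eq_iff_cong[OF h(1)] cong_p cong_trans by blast
    then have "int p dvd 1" by (simp add: cong_iff_dvd_diff)
    then show False using p1 by simp
  qed
  have a1: "[a = 1] (mod int p)"
  proof (rule ccontr)
    assume "\<not> [a = 1] (mod int p)"
    then have "coprime (a - 1) (int p)"
      using pr by (metis cong_iff_dvd_diff coprime_commute prime_imp_coprime)
    \<comment> \<open>With \<open>x\<close> inverse to \<open>a - 1\<close> modulo \<open>p\<close>,
      the residue of \<open>x * - b\<close> would be a fixed point.\<close>
    then obtain x where "[(a - 1) * x = 1] (mod int p)" using cong_solve_coprime_int by blast
    then have "[(a - 1) * x * (- b) = 1 * (- b)] (mod int p)" by (intro cong_mult) auto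
    then have "int p dvd (a - 1) * (x * - b) + b" by (simp add: cong_iff_dvd_diff algebra_simps)
    then show False using no_fixed by blast
  qed
  have "\<not> int p dvd b" using no_fixed[of 0] by simp
  then have "coprime (int p) b" by (rule prime_imp_coprime[OF pr])
  then have cop: "coprime b m" by (simp add: coprime_commute)
  obtain b' where b': "[b * b' = 1] (mod m)" using cong_solve_coprime_int[OF cop] by blast
  \<comment> \<open>Dividing labels by the unit \<open>b\<close> turns
    \<open>i \<mapsto> a * i + b\<close> into \<open>i \<mapsto> a * i + 1\<close> and keeps the
    group of translations.\<close>
  define h' where "h' i = h (b * i)" for i
  have hh': "h j = h' (b' * j)" for j
  proof -
    have "[b * b' * j = 1 * j] (mod m)" using b' by (intro cong_mult) auto
    then have "[j = b * (b' * j)] (mod m)" by (simp add: mult.assoc cong_sym_eq)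
    then show ?thesis unfolding h'_def coordinate_eq_iff_cong[OF h(1)] .
  qed
  have h'eq: "h' i = h' j \<longleftrightarrow> [i = j] (mod m)" for i j
    unfolding h'_def coordinate_eq_iff_cong[OF h(1)] using cop by (rule cong_mult_lcancel)
  have "range h' = \<Omega>"
  proof
    show "range h' \<subseteq> \<Omega>" using mem by (auto simp: h'_def)
    show "\<Omega> \<subseteq> range h'"
    proof
      fix x assume "x \<in> \<Omega>"
      then obtain j where "x = h j" by (rule coordinateE[OF h(1)])
      then show "x \<in> range h'" using hh'[of j] by simp
    qed
  qed
  then have coord': "coordinate (p ^ n) \<Omega> h'" unfolding coordinate_def using h'eq by simp
  have shift': "shift \<Omega> h' j = shift \<Omega> h (b * j)" for j
  proof (rule extensional_eqI[OF coord' shift_extensional shift_extensional])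
    show "shift \<Omega> h' j (h' i) = shift \<Omega> h (b * j) (h' i)" for i
      unfolding shift_apply[OF coord'] unfolding h'_def shift_apply[OF h(1)] by (simp add: algebra_simps)
  qed
  have "shift \<Omega> h j = shift \<Omega> h' (b' * j)" for j
  proof -
    have "[b * b' * j = 1 * j] (mod m)" using b' by (intro cong_mult) auto
    then have "[j = b * (b' * j)] (mod int (p ^ n))" by (simp add: mult.assoc cong_sym_eq)
    then show ?thesis unfolding shift' shift_eq_iff[OF h(1)] .
  qed
  then have "shift \<Omega> h j \<in> range (shift \<Omega> h')" for j by blast
  moreover have "shift \<Omega> h' j \<in> range (shift \<Omega> h)" for j unfolding shift' by blast
  ultimately have rng: "range (shift \<Omega> h') = range (shift \<Omega> h)" by blast
  have aff: "affine (a mod m) h'"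
    unfolding affine_def
  proof (intro conjI allI coord')
    show "h' 0 = e 0" using h(2) by (simp add: h'_def)
    fix i
    have "?c (h' i) = h' (a * i + 1)" unfolding h'_def ch by (simp add: algebra_simps)
    also have "\<dots> = h' (a mod m * i + 1)"
      unfolding h'eq by (intro cong_add cong_mult) (auto simp: cong_def)
    finally show "?c (h' i) = h' (a mod m * i + 1)" .
  qed
  have "[a mod m = a] (mod m)" by simp
  then have "[a mod m = 1] (mod int p)" using cong_p a1 cong_trans by blast
  then show ?thesis using that aff rng m_pos(2) by simp
qed

section \<open>Counting the cyclic regular subgroups normalized by the cycle\<close>

definition cyclic_regular :: "('x \<Rightarrow> 'x) set \<Rightarrow> ('x \<Rightarrow> 'x) set set" where
  "cyclic_regular C = {N. regular_subgroup N \<Omega> \<and>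
     BijGroup \<Omega> \<lparr>carrier := N\<rparr> \<cong> integer_mod_group (p ^ n) \<and> (\<forall>c\<in>C. normalizes \<Omega> c N)}"

lemma cyclic_regular_obtain_affine:
  assumes "N \<in> cyclic_regular C" "shift \<Omega> e 1 \<in> C"
  obtains a h where "[a = 1] (mod int p)" "0 \<le> a" "a < m" "affine a h" "N = range (shift \<Omega> h)"
proof -
  have N: "regular_subgroup N \<Omega>" "BijGroup \<Omega> \<lparr>carrier := N\<rparr> \<cong> integer_mod_group (p ^ n)"
    "normalizes \<Omega> (shift \<Omega> e 1) N"
    using assms unfolding cyclic_regular_def by blast+
  obtain h where h: "coordinate (p ^ n) \<Omega> h" "N = range (shift \<Omega> h)" "h 0 = e 0"
    by (rule regular_cyclic_obtain_coordinate[OF N(1) m_pos(1) coordinate_mem[OF e, of 0] N(2)])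
  obtain a h' where a: "[a = 1] (mod int p)" "0 \<le> a" "a < m" "affine a h'"
    "range (shift \<Omega> h') = range (shift \<Omega> h)"
    by (rule normalized_obtain_affine[OF h(1,3) N(3)[unfolded h(2)]])
  then show ?thesis using that[OF a(1-4)] h(2) by simp
qed

lemma range_shift_affine_cyclic_regular:
  assumes "affine a h" "C \<subseteq> range (\<lambda>k. shift \<Omega> e (int k))"
  shows "range (shift \<Omega> h) \<in> cyclic_regular C"
  using regular_subgroup_range_shift[OF affineD(1)[OF assms(1)]]
    range_shift_iso[OF affineD(1)[OF assms(1)] m_pos(1)] shift_normalizes[OF assms(1)] assms(2)
  unfolding cyclic_regular_def by blast

text \<open>The subgroups are parametrized by the residues \<open>a\<close> congruent to 1 modulo
  \<open>p\<close>. To recover \<open>a\<close> from the subgroup: its element moving the base point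
  to the next point of the cycle is translation by 1, so it determines the labelling, in which the
  cycle sends label 1 to \<open>a + 1\<close>.\<close>

theorem card_cyclic_regular:
  assumes C: "C \<subseteq> range (\<lambda>k. shift \<Omega> e (int k))" "shift \<Omega> e 1 \<in> C"
  shows "card (cyclic_regular C) = p ^ (n - 1)"
proof -
  let ?S = "{a \<in> {0..<m}. [a = 1] (mod int p)}"
  define H where "H a = (SOME h. affine a h)" for a
  have H: "affine a (H a)" if a: "a \<in> ?S" for a
  proof -
    obtain h where "affine a h" by (rule affine_exists[of a]) (use a in simp)
    then show ?thesis unfolding H_def by (rule someI[of "affine a"])
  qed
  have "inj_on (\<lambda>a. range (shift \<Omega> (H a))) ?S"
  proof (rule inj_onI)
    fix a b assume ab: "a \<in> ?S" "b \<in> ?S" and eq: "range (shift \<Omega> (H a)) = range (shift \<Omega> (H b))"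
    note A = affineD[OF H[OF ab(1)]] and B = affineD[OF H[OF ab(2)]]
    \<comment> \<open>In every affine labelling the successor of the base point along the cycle has
      label 1.\<close>
    have first: "H a 1 = H b 1" using A(3)[of 0] B(3)[of 0] A(2) B(2) by simp
    have "shift \<Omega> (H a) 1 \<in> range (shift \<Omega> (H b))" using eq by blast
    then obtain j where j: "shift \<Omega> (H a) 1 = shift \<Omega> (H b) j" by blast
    then have "H a 1 = H b j"
      using shift_apply[OF A(1), of 1 0] shift_apply[OF B(1), of j 0] A(2) B(2) by simp
    then have "[j = 1] (mod m)" using first coordinate_eq_iff_cong[OF B(1), of j 1] by simp
    then have s: "shift \<Omega> (H a) 1 = shift \<Omega> (H b) 1"
      using j shift_eq_iff[OF B(1)] by simp
    have nat: "H a (int k) = H b (int k)" for k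
    proof (induction k)
      case 0
      then show ?case using A(2) B(2) by simp
    next
      case (Suc k)
      have "H a (int (Suc k)) = shift \<Omega> (H a) 1 (H a (int k))"
        by (simp add: shift_apply[OF A(1)] add.commute)
      also have "\<dots> = shift \<Omega> (H b) 1 (H b (int k))" using Suc s by simp
      also have "\<dots> = H b (int (Suc k))" by (simp add: shift_apply[OF B(1)] add.commute)
      finally show ?case .
    qed
    have "shift \<Omega> e 1 (H a 1) = H a (a + 1)" "shift \<Omega> e 1 (H b 1) = H b (b + 1)"
      using A(3)[of 1] B(3)[of 1] by simp_all
    moreover have "H a (a + 1) = H b (a + 1)" using nat[of "nat (a + 1)"] ab(1) by simp
    ultimately have "H b (a + 1) = H b (b + 1)" using first by simp
    then have "[a + 1 = b + 1] (mod m)" unfolding coordinate_eq_iff_cong[OF B(1)] .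
    then have "[a = b] (mod m)" by (simp add: cong_add_rcancel)
    then show "a = b" using ab by (simp add: cong_def)
  qed
  moreover have "(\<lambda>a. range (shift \<Omega> (H a))) ` ?S = cyclic_regular C"
  proof
    show "(\<lambda>a. range (shift \<Omega> (H a))) ` ?S \<subseteq> cyclic_regular C"
      using range_shift_affine_cyclic_regular[OF H C(1)] by blast
    show "cyclic_regular C \<subseteq> (\<lambda>a. range (shift \<Omega> (H a))) ` ?S"
    proof
      fix N assume N: "N \<in> cyclic_regular C"
      obtain a h where ah: "[a = 1] (mod int p)" "0 \<le> a" "a < m" "affine a h" "N = range (shift \<Omega> h)"
        by (rule cyclic_regular_obtain_affine[OF N C(2)])
      then have aS: "a \<in> ?S" by simp
      then have "h = H a" using affine_unique[OF ah(4) H ah(1)] by blast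
      then show "N \<in> (\<lambda>a. range (shift \<Omega> (H a))) ` ?S" using aS ah(5) by blast
    qed
  qed
  ultimately show ?thesis
    using card_image[of "\<lambda>a. range (shift \<Omega> (H a))" ?S] card_cong_1[OF p(1) n] by simp
qed

text \<open>Along the cycle \<open>d\<close> is multiplication by \<open>r\<close>; in a labelling
  \<open>h\<close> belonging to a normalized \<open>N\<close> it is multiplication by some
  \<open>s\<close>, since it fixes the base point and normalizes the translations. Comparing the two
  descriptions at the first two points after the base point gives \<open>a \<equiv> a ^ r\<close>
  modulo \<open>p ^ n\<close>.\<close>

theorem cyclic_regular_unique:
  assumes C: "shift \<Omega> e 1 \<in> C" "\<And>c. c \<in> C \<Longrightarrow> normalizes \<Omega> c (range (shift \<Omega> e))"
    and d: "d \<in> C" "d \<in> Bij \<Omega>" "\<And>k. d (e (int k)) = e (int (r * k))"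
    and r: "r \<ge> 1" "\<not> [int r = 1] (mod int p)"
  shows "cyclic_regular C = {range (shift \<Omega> e)}"
proof (intro equalityI subsetI)
  fix N assume "N \<in> {range (shift \<Omega> e)}"
  then show "N \<in> cyclic_regular C"
    using C(2) regular_subgroup_range_shift[OF e] range_shift_iso[OF e m_pos(1)]
    unfolding cyclic_regular_def by blast
next
  fix N assume N: "N \<in> cyclic_regular C"
  obtain a h where ah: "[a = 1] (mod int p)" "0 \<le> a" "a < m" "affine a h" "N = range (shift \<Omega> h)"
    by (rule cyclic_regular_obtain_affine[OF N C(1)])
  note A = affineD[OF ah(4)]
  have mem: "h i \<in> \<Omega>" for i using coordinate_mem[OF A(1)] .
  have dinj: "d x = d y \<longleftrightarrow> x = y" if "x \<in> \<Omega>" "y \<in> \<Omega>" for x y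
    using d(2) that unfolding Bij_def bij_betw_def inj_on_def by blast
  have "normalizes \<Omega> d (range (shift \<Omega> h))"
    using N d(1) ah(5) unfolding cyclic_regular_def by blast
  then obtain s where s: "\<And>x. x \<in> \<Omega> \<Longrightarrow> d (shift \<Omega> h 1 x) = shift \<Omega> h s (d x)"
    unfolding normalizes_def by blast
  have dh: "d (h (int i)) = h (s * int i)" for i
  proof (induction i)
    case 0
    then show ?case using d(3)[of 0] A(2) by simp
  next
    case (Suc i)
    have "d (h (int (Suc i))) = d (shift \<Omega> h 1 (h (int i)))"
      by (simp add: shift_apply[OF A(1)] add.commute)
    also have "\<dots> = shift \<Omega> h s (d (h (int i)))" by (rule s[OF mem])
    also have "\<dots> = h (s * int (Suc i))"
      unfolding Suc shift_apply[OF A(1)] by (simp add: algebra_simps)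
    finally show ?case .
  qed
  \<comment> \<open>Both are the image under \<open>d\<close> of \<open>e 1 = h 1\<close>.\<close>
  have "h (geom_sum a r) = h s"
    using affine_geo[OF ah(4), of 1] affine_geo[OF ah(4), of r] d(3)[of 1] dh[of 1] by simp
  then have s_cong: "[geom_sum a r = s] (mod m)" unfolding coordinate_eq_iff_cong[OF A(1)] .
  \<comment> \<open>\<open>dh\<close> covers only natural labels, and these two are nonnegative as
    \<open>a\<close> is.\<close>
  have a_nat: "1 + a = int (nat (1 + a))" "1 + a ^ r = int (nat (1 + a ^ r))" using ah(2) by simp_all
  \<comment> \<open>The point \<open>e 2\<close> has label \<open>1 + a\<close>. Rewriting its image
    as \<open>d (h (1 + a ^ r))\<close> lets injectivity of \<open>d\<close> replace a division by
    \<open>s\<close>.\<close>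
  have "d (h (1 + a)) = d (e (int 2))"
    using affine_geo[OF ah(4), of 2] by (simp add: geom_sum_2)
  also have "\<dots> = h (geom_sum a (r * 2))" using d(3)[of 2] affine_geo[OF ah(4), of "r * 2"] by simp
  also have "\<dots> = h (geom_sum a r * (1 + a ^ r))" by (simp only: geom_sum_mult geom_sum_2)
  also have "\<dots> = h (s * (1 + a ^ r))"
    unfolding coordinate_eq_iff_cong[OF A(1)] using s_cong by (intro cong_mult) auto
  also have "\<dots> = d (h (1 + a ^ r))" using dh[of "nat (1 + a ^ r)"] a_nat(2) by simp
  finally have "h (1 + a) = h (1 + a ^ r)" using dinj[OF mem mem] by blast
  then have "[1 + a = 1 + a ^ r] (mod m)" unfolding coordinate_eq_iff_cong[OF A(1)] .
  then have ar: "[a * 1 = a * a ^ (r - 1)] (mod m)"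
    using r(1) by (simp add: cong_add_lcancel power_eq_if)
  have "[a ^ (r - 1) = 1] (mod m)"
    using ar cong_mult_lcancel[OF coprime_cong_1[OF ah(1), of n]] cong_sym by blast
  moreover have "\<not> p dvd r - 1"
  proof
    assume "p dvd r - 1"
    then have "int p dvd int (r - 1)" by (simp only: int_dvd_int_iff)
    then show False using r by (simp add: cong_iff_dvd_diff of_nat_diff)
  qed
  ultimately have a1: "[a = 1] (mod m)" using cong_1_of_power[OF p(1) ah(1)] by blast
  \<comment> \<open>For \<open>a \<equiv> 1\<close> both \<open>h\<close> and \<open>e\<close> are
    affine with parameter 1, so they coincide.\<close>
  have "affine 1 h"
    unfolding affine_def
  proof (intro conjI allI A(1,2))
    fix i
    have "h (a * i + 1) = h (1 * i + 1)"
      unfolding coordinate_eq_iff_cong[OF A(1)] using a1 by (intro cong_add cong_mult) auto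
    then show "shift \<Omega> e 1 (h i) = h (1 * i + 1)" using A(3)[of i] by simp
  qed
  moreover have "affine 1 e" unfolding affine_def using e shift_apply[OF e] by simp
  ultimately have "h = e" using affine_unique by (metis cong_refl)
  then show "N \<in> {range (shift \<Omega> e)}" using ah(5) by simp
qed

end

section \<open>Actions on cosets\<close>

text \<open>The set behind the Hopf Galois structures of cyclic type, for an abstract group and
  subgroup.\<close>

definition normalized_cyclic_regular ::
    "('g, 'm) monoid_scheme \<Rightarrow> 'g set \<Rightarrow> nat \<Rightarrow> ('g set \<Rightarrow> 'g set) set set" where
  "normalized_cyclic_regular G H m =
     {N. regular_subgroup N (lcosets\<^bsub>G\<^esub> H) \<and>
         (\<forall>g \<in> carrier G. \<forall>\<eta> \<in> N.
            coset_action G H g \<otimes>\<^bsub>BijGroup (lcosets\<^bsub>G\<^esub> H)\<^esub> \<eta> \<otimes>\<^bsub>BijGroup (lcosets\<^bsub>G\<^esub> H)\<^esub>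
              inv\<^bsub>BijGroup (lcosets\<^bsub>G\<^esub> H)\<^esub> (coset_action G H g) \<in> N) \<and>
         BijGroup (lcosets\<^bsub>G\<^esub> H) \<lparr>carrier := N\<rparr> \<cong> integer_mod_group m}"

context group
begin

section \<open>Cosets labelled by the powers of one element\<close>

lemma coset_action_apply:
  assumes "subgroup H G" "g \<in> carrier G" "a \<in> carrier G"
  shows "coset_action G H g (a <# H) = (g \<otimes> a) <# H"
  using assms lcos_m_assoc[OF subgroup.subset[OF assms(1)] assms(2,3)]
  unfolding coset_action_def LCOSETS_def by auto

lemma coset_action_Bij:
  assumes H: "subgroup H G" and g: "g \<in> carrier G"
  shows "coset_action G H g \<in> Bij (lcosets H)"
proof -
  have mem: "a <# H \<in> lcosets H" if "a \<in> carrier G" for a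
    using that unfolding LCOSETS_def by blast
  have ex: "\<exists>a \<in> carrier G. C = a <# H" if "C \<in> lcosets H" for C
    using that unfolding LCOSETS_def by blast
  have inv: "coset_action G H g (coset_action G H (inv g) C) = C"
    "coset_action G H (inv g) (coset_action G H g C) = C"
    "coset_action G H g C \<in> lcosets H" "coset_action G H (inv g) C \<in> lcosets H" if C: "C \<in> lcosets H" for C
  proof -
    obtain a where "a \<in> carrier G" "C = a <# H" using ex[OF C] by blast
    then show "coset_action G H g (coset_action G H (inv g) C) = C"
      "coset_action G H (inv g) (coset_action G H g C) = C"
      "coset_action G H g C \<in> lcosets H" "coset_action G H (inv g) C \<in> lcosets H"
      using g by (simp_all add: coset_action_apply[OF H] m_assoc[symmetric] mem)
  qed
  have "bij_betw (coset_action G H g) (lcosets H) (lcosets H)"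
    by (rule bij_betwI[where g = "coset_action G H (inv g)"]) (use inv in auto)
  moreover have "coset_action G H g \<in> extensional (lcosets H)"
    by (simp add: coset_action_def)
  ultimately show ?thesis unfolding Bij_def by blast
qed

text \<open>The cosets of the powers of \<open>c\<close> are distinct modulo \<open>m\<close>, and
  there are only \<open>m\<close> cosets. So \<open>c\<close> acts as an
  \<open>m\<close>-cycle.\<close>

lemma coordinate_cosets:
  assumes H: "subgroup H G" and c: "c \<in> carrier G" and m: "m > 0" "card (lcosets H) = m"
    and pow: "\<And>i::int. c [^] i \<in> H \<longleftrightarrow> int m dvd i"
  shows "coordinate m (lcosets H) (\<lambda>i::int. (c [^] i) <# H)"
proof -
  let ?e = "\<lambda>i::int. (c [^] i) <# H"
  have eq: "?e i = ?e j \<longleftrightarrow> [i = j] (mod int m)" for i j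
  proof -
    have "inv (c [^] i) \<otimes> c [^] j = c [^] (j - i)"
      using c by (simp add: int_pow_neg[symmetric] int_pow_mult[symmetric])
    then have "?e i = ?e j \<longleftrightarrow> int m dvd j - i"
      using lcoset_eq_iff[OF H, of "c [^] i" "c [^] j"] c pow by simp
    then show ?thesis by (simp add: cong_iff_dvd_diff dvd_diff_commute)
  qed
  have "inj_on ?e {0..<int m}"
    using eq by (auto simp: inj_on_def cong_def)
  then have "card (?e ` {0..<int m}) = m" by (simp add: card_image)
  moreover have sub: "range ?e \<subseteq> lcosets H" using c unfolding LCOSETS_def by auto
  moreover have "finite (lcosets H)" using m by (intro card_ge_0_finite) simp
  ultimately have "?e ` {0..<int m} = lcosets H" using m(2) by (intro card_subset_eq) auto
  then have "range ?e = lcosets H" using sub by blast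
  then show ?thesis unfolding coordinate_def using eq by simp
qed

lemma coset_action_pow:
  assumes H: "subgroup H G" and c: "c \<in> carrier G"
    and e: "coordinate m (lcosets H) (\<lambda>i::int. (c [^] i) <# H)"
  shows "coset_action G H (c [^] (j::int)) = shift (lcosets H) (\<lambda>i. (c [^] i) <# H) j"
proof (rule extensional_eqI[OF e _ shift_extensional])
  show "coset_action G H (c [^] j) \<in> extensional (lcosets H)" by (simp add: coset_action_def)
  show "coset_action G H (c [^] j) ((c [^] i) <# H) =
    shift (lcosets H) (\<lambda>i. (c [^] i) <# H) j ((c [^] i) <# H)" for i :: int
    using c unfolding shift_apply[OF e]
    by (simp add: coset_action_apply[OF H] int_pow_mult[symmetric] add.commute)
qed

lemma normalized_cyclic_regular_eq:
  assumes H: "subgroup H G" and "prime_power_cycle p n (lcosets H) e"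
  shows "normalized_cyclic_regular G H (p ^ n) =
    prime_power_cycle.cyclic_regular p n (lcosets H) (coset_action G H ` carrier G)"
proof -
  interpret prime_power_cycle p n "lcosets H" e by fact
  have "(\<forall>g \<in> carrier G. \<forall>\<eta> \<in> N.
            coset_action G H g \<otimes>\<^bsub>BijGroup (lcosets H)\<^esub> \<eta> \<otimes>\<^bsub>BijGroup (lcosets H)\<^esub>
              inv\<^bsub>BijGroup (lcosets H)\<^esub> (coset_action G H g) \<in> N) \<longleftrightarrow>
    (\<forall>c \<in> coset_action G H ` carrier G. normalizes (lcosets H) c N)"
    if "regular_subgroup N (lcosets H)" for N
  proof -
    have "subgroup N (BijGroup (lcosets H))" using that unfolding regular_subgroup_def by blast
    then have "N \<subseteq> Bij (lcosets H)" using subgroup.subset by (fastforce simp: BijGroup_def)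
    then show ?thesis using conj_mem_iff_normalizes[OF coset_action_Bij[OF H]] by blast
  qed
  then show ?thesis
    unfolding normalized_cyclic_regular_def cyclic_regular_def by blast
qed

text \<open>With trivial \<open>H\<close> the cosets are singletons, so a generator \<open>c\<close>
  has order \<open>p ^ n\<close> and acts as a full cycle. All of \<open>G\<close> acts through
  powers of this cycle and imposes no condition beyond the one from \<open>c\<close>.\<close>

lemma card_normalized_cyclic_regular_cyclic:
  assumes p: "Factorial_Ring.prime p" "odd p" "n \<ge> 1" and H: "H = {\<one>}"
    and idx: "card (lcosets H) = p ^ n" and cyc: "cyclic_group G"
  shows "card (normalized_cyclic_regular G H (p ^ n)) = p ^ (n - 1)"
proof -
  have sub: "subgroup H G" unfolding H by (rule triv_subgroup)
  have pos: "p ^ n > 0" using prime_gt_0_nat[OF p(1)] by simp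
  obtain c where c: "c \<in> carrier G" "carrier G = range (\<lambda>i::int. c [^] i)"
    using cyc unfolding cyclic_group by blast
  have "lcosets H = (\<lambda>a. {a}) ` carrier G"
    unfolding LCOSETS_def H l_coset_def by auto
  then have card: "card (carrier G) = p ^ n"
    using idx by (simp add: card_image)
  then have fin: "finite (carrier G)" using pos by (intro card_ge_0_finite) simp
  have "carrier G \<subseteq> (\<lambda>k. c [^] int k) ` {..<ord c}"
  proof
    fix x assume "x \<in> carrier G"
    then obtain i :: int where i: "x = c [^] i" using c(2) by blast
    have o: "ord c > 0" using ord_ge_1[OF fin c(1)] by simp
    have "c [^] i = c [^] int (nat (i mod int (ord c)))"
      using o c(1) by (simp add: int_pow_eq mod_eq_dvd_iff[symmetric])
    moreover have "nat (i mod int (ord c)) < ord c" using o by (simp add: nat_less_iff)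
    ultimately show "x \<in> (\<lambda>k. c [^] int k) ` {..<ord c}" using i by blast
  qed
  then have "p ^ n \<le> ord c"
    using card card_mono[of "(\<lambda>k. c [^] int k) ` {..<ord c}" "carrier G"]
      card_image_le[of "{..<ord c}" "\<lambda>k. c [^] int k"] by simp
  moreover have "ord c \<le> p ^ n" using ord_le_group_order[OF fin c(1)] card by (simp add: order_def)
  ultimately have ord: "ord c = p ^ n" by simp
  have pow: "c [^] i \<in> H \<longleftrightarrow> int (p ^ n) dvd i" for i :: int
    unfolding H using int_pow_eq_id[OF c(1), of i] ord by simp
  let ?e = "\<lambda>i::int. (c [^] i) <# H"
  note e = coordinate_cosets[OF sub c(1) pos idx pow]
  have cyc: "prime_power_cycle p n (lcosets H) ?e" using p e by unfold_locales
  then interpret prime_power_cycle p n "lcosets H" ?e .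
  have "coset_action G H ` carrier G \<subseteq> range (\<lambda>k. shift (lcosets H) ?e (int k))"
  proof
    fix a assume "a \<in> coset_action G H ` carrier G"
    then obtain i :: int where "a = shift (lcosets H) ?e i"
      using c(2) coset_action_pow[OF sub c(1) e] by auto
    \<comment> \<open>\<open>card_cyclic_regular\<close> takes natural powers of the cycle, so the
      exponent is reduced modulo \<open>p ^ n\<close>.\<close>
    moreover have "shift (lcosets H) ?e i = shift (lcosets H) ?e (int (nat (i mod int (p ^ n))))"
      using pos by (simp add: shift_eq_iff[OF e] cong_def del: of_nat_power)
    ultimately show "a \<in> range (\<lambda>k. shift (lcosets H) ?e (int k))" by blast
  qed
  moreover have "shift (lcosets H) ?e 1 \<in> coset_action G H ` carrier G"
    using coset_action_pow[OF sub c(1) e, of 1] c(1) by (metis imageI int_pow_closed)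
  ultimately show ?thesis
    using card_cyclic_regular normalized_cyclic_regular_eq[OF sub cyc] by simp
qed

end

section \<open>Automorphisms of a cyclic group and the semidirect product\<close>

lemma AutoGroup_integer_mod_group_apply:
  assumes "f \<in> carrier (AutoGroup (integer_mod_group m))" "m > 1"
  shows "f 1 \<in> {0..<int m}" "f (int k mod int m) = (int k * f 1) mod int m"
proof -
  let ?Z = "integer_mod_group m"
  have f: "f \<in> hom ?Z ?Z" using assms(1) by (simp add: AutoGroup_def auto_def)
  have mem: "i mod int m \<in> carrier ?Z" for i using assms(2) by (simp add: carrier_integer_mod_group)
  show f1: "f 1 \<in> {0..<int m}"
    using hom_in_carrier[OF f, of 1] assms(2) by (simp add: carrier_integer_mod_group)
  show "f (int k mod int m) = (int k * f 1) mod int m"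
  proof (induction k)
    case 0
    have "f 0 = 0" using hom_one[OF f] by simp
    then show ?case by simp
  next
    case (Suc k)
    have "int (Suc k) mod int m = (int k mod int m + 1) mod int m"
      by (simp add: mod_simps add.commute)
    also have "f \<dots> = (f (int k mod int m) + f 1) mod int m"
      using hom_mult[OF f mem[of "int k"], of 1] assms(2) by simp
    finally show ?case unfolding Suc by (simp add: mod_simps algebra_simps)
  qed
qed

text \<open>An automorphism is multiplication by its value at the generator 1.\<close>

lemma AutoGroup_integer_mod_group_eqI:
  assumes "f \<in> carrier (AutoGroup (integer_mod_group m))" "g \<in> carrier (AutoGroup (integer_mod_group m))"
    "m > 1" "f 1 = g 1"
  shows "f = g"
proof (rule extensionalityI)
  show "f \<in> extensional (carrier (integer_mod_group m))" "g \<in> extensional (carrier (integer_mod_group m))"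
    using assms(1,2) by (simp_all add: AutoGroup_def auto_def Bij_imp_extensional)
  fix x assume "x \<in> carrier (integer_mod_group m)"
  then have "x = int (nat x) mod int m" using assms(3) by (simp add: carrier_integer_mod_group)
  then show "f x = g x"
    using AutoGroup_integer_mod_group_apply(2)[OF assms(1,3), of "nat x"]
      AutoGroup_integer_mod_group_apply(2)[OF assms(2,3), of "nat x"] assms(4) by simp
qed

context group
begin

lemma conj_pow:
  assumes "g \<in> carrier G" "c \<in> carrier G" "g \<otimes> c = c [^] r \<otimes> g"
  shows "g \<otimes> c [^] (k::nat) = c [^] (r * k :: nat) \<otimes> g"
proof (induction k)
  case (Suc k)
  have "g \<otimes> c [^] Suc k = (g \<otimes> c [^] k) \<otimes> c" using assms by (simp add: m_assoc)
  also have "\<dots> = c [^] (r * k) \<otimes> (g \<otimes> c)" using assms Suc by (simp add: m_assoc)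
  also have "\<dots> = (c [^] (r * k) \<otimes> c [^] r) \<otimes> g" using assms by (simp add: m_assoc)
  also have "\<dots> = c [^] (r * Suc k) \<otimes> g" using assms by (simp add: nat_pow_mult add.commute)
  finally show ?case .
qed (use assms in simp)

lemma pow_conj:
  assumes "g \<in> carrier G" "c \<in> carrier G" "g \<otimes> c = c [^] r \<otimes> g"
  shows "g [^] (j::nat) \<otimes> c = c [^] (r ^ j :: nat) \<otimes> g [^] j"
proof (induction j)
  case (Suc j)
  have "g [^] Suc j \<otimes> c = g [^] j \<otimes> (c [^] r \<otimes> g)" using assms by (simp add: m_assoc)
  also have "\<dots> = (g [^] j \<otimes> c [^] r) \<otimes> g" using assms by (simp add: m_assoc)
  also have "g [^] j \<otimes> c [^] r = c [^] (r ^ j * r) \<otimes> g [^] j"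
    using conj_pow[OF _ assms(2) Suc, of r] assms by simp
  finally show ?case using assms by (simp add: m_assoc mult.commute)
qed (use assms in simp)

text \<open>Let \<open>c\<close> correspond to the generator of the normal factor. By Lagrange
  \<open>H\<close> has order \<open>D\<close>, prime to \<open>p\<close>, so it meets the powers of
  \<open>c\<close> trivially and \<open>c\<close> acts on the cosets as a full cycle. Its
  translations are normalized by \<open>G\<close>; a nontrivial element of \<open>H\<close> excludes
  every other subgroup.\<close>

lemma card_normalized_cyclic_regular_semidirect:
  assumes p: "Factorial_Ring.prime p" "odd p" "n \<ge> 1" and H: "subgroup H G"
    and idx: "card (lcosets H) = p ^ n"
    and D: "D > 1" "D dvd p - 1"
    and \<phi>: "\<phi> \<in> hom (integer_mod_group D) (AutoGroup (integer_mod_group (p ^ n)))"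
      "inj_on \<phi> (carrier (integer_mod_group D))"
    and iso: "G \<cong> semidirect_product (integer_mod_group (p ^ n)) (integer_mod_group D) \<phi>"
  shows "card (normalized_cyclic_regular G H (p ^ n)) = 1"
proof -
  let ?m = "p ^ n"
  let ?Z = "integer_mod_group ?m" and ?Y = "integer_mod_group D"
  let ?S = "semidirect_product ?Z ?Y \<phi>"
  have pos: "?m > 0" using prime_gt_0_nat[OF p(1)] by simp
  have m1: "?m > 1" using prime_gt_1_nat[OF p(1)] p(3) by (intro one_less_power) simp_all
  then have m1i: "int p ^ n > 1" by (metis of_nat_1 of_nat_less_iff of_nat_power)
  have "D < p" using D prime_gt_1_nat[OF p(1)] dvd_imp_le[OF D(2)] by linarith
  then have pD: "\<not> p dvd D" using D(1) by (simp add: nat_dvd_not_less)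
  then have copD: "coprime ?m D" using p(1) by (simp add: prime_imp_coprime)
  obtain f where f: "f \<in> hom G ?S" "bij_betw f (carrier G) (carrier ?S)"
    using iso unfolding is_iso_def iso_def by blast
  have Sc: "carrier ?S = {0..<int ?m} \<times> {0..<int D}"
    using pos D(1) by (simp add: semidirect_product_def carrier_integer_mod_group)
  have fm: "f (x \<otimes> y) = ((fst (f x) + \<phi> (snd (f x)) (fst (f y))) mod int ?m,
      (snd (f x) + snd (f y)) mod int D)" if "x \<in> carrier G" "y \<in> carrier G" for x y
    using hom_mult[OF f(1) that] by (simp add: semidirect_product_def split_beta)
  have fc: "fst (f x) \<in> {0..<int ?m}" "snd (f x) \<in> {0..<int D}" if "x \<in> carrier G" for x
    using hom_in_carrier[OF f(1) that] unfolding Sc by (auto simp: mem_Times_iff)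
  have finj: "x = y" if "x \<in> carrier G" "y \<in> carrier G" "f x = f y" for x y
    using inj_onD[OF bij_betw_imp_inj_on[OF f(2)] that(3,1,2)] .
  have fsurj: "\<exists>x \<in> carrier G. f x = s" if "s \<in> carrier ?S" for s
    using f(2) that unfolding bij_betw_def by (metis imageE)
  have \<phi>c: "\<phi> b \<in> carrier (AutoGroup ?Z)" if "b \<in> {0..<int D}" for b
    using hom_in_carrier[OF \<phi>(1), of b] that D(1) by (simp add: carrier_integer_mod_group)
  have \<phi>0: "\<phi> 0 i = i" if "i \<in> {0..<int ?m}" for i
  proof -
    interpret Z: group ?Z by simp
    have "\<phi> 0 = (\<lambda>x\<in>carrier ?Z. x)"
      using hom_one[OF \<phi>(1) group_integer_mod_group Z.AutoGroup]
      by (simp add: AutoGroup_def BijGroup_def)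
    then show ?thesis using that pos by (simp add: carrier_integer_mod_group)
  qed
  \<comment> \<open>\<open>f \<one>\<close> is idempotent. The second coordinate is settled first,
    since then the action on the first is by \<open>\<phi> 0\<close>, the identity.\<close>
  have f1: "f \<one> = (0, 0)"
  proof -
    have eq: "f \<one> = ((fst (f \<one>) + \<phi> (snd (f \<one>)) (fst (f \<one>))) mod int ?m,
      (snd (f \<one>) + snd (f \<one>)) mod int D)" using fm[of \<one> \<one>] by simp
    have double: "i = 0" if "0 \<le> i" "i < j" "i = (i + i) mod j" for i j :: int
    proof -
      have "j dvd i" using that(3) by (metis add_diff_cancel_left' mod_eq_dvd_iff mod_mod_trivial)
      then show ?thesis using that(1,2) zdvd_not_zless by force
    qed
    have "snd (f \<one>) = (snd (f \<one>) + snd (f \<one>)) mod int D" using arg_cong[OF eq, of snd] by simp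
    then have s0: "snd (f \<one>) = 0" using double[of "snd (f \<one>)" "int D"] fc(2)[OF one_closed] by simp
    have "fst (f \<one>) = (fst (f \<one>) + fst (f \<one>)) mod int ?m"
      using arg_cong[OF eq, of fst] \<phi>0[OF fc(1)[OF one_closed]] by (simp add: s0)
    then have "fst (f \<one>) = 0" using double[of "fst (f \<one>)" "int ?m"] fc(1)[OF one_closed] by simp
    then show ?thesis using s0 by (simp add: prod_eq_iff)
  qed
  obtain c where c: "c \<in> carrier G" "f c = (1, 0)"
    using fsurj[of "(1, 0)"] m1i D(1) unfolding Sc by auto
  have fpow: "f (c [^] k) = (int k mod int ?m, 0)" for k :: nat
  proof (induction k)
    case (Suc k)
    have "f (c [^] Suc k) = ((int k mod int ?m + \<phi> 0 1) mod int ?m, 0)"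
      using fm[of "c [^] k" c] c Suc by simp
    then show ?case using \<phi>0[of 1] m1i by (simp add: mod_simps add.commute)
  qed (simp add: f1)
  have ord: "ord c = ?m"
    unfolding ord_unique[OF c(1)]
  proof
    fix k :: nat
    have "c [^] k = \<one> \<longleftrightarrow> f (c [^] k) = f \<one>" using finj c(1) by auto
    also have "\<dots> \<longleftrightarrow> int ?m dvd int k" unfolding fpow f1 by (simp add: dvd_eq_mod_eq_0)
    finally show "c [^] k = \<one> \<longleftrightarrow> ?m dvd k" by (simp only: int_dvd_int_iff)
  qed
  have cG: "card (carrier G) = ?m * D"
    using bij_betw_same_card[OF f(2)] unfolding Sc by (simp add: card_cartesian_product del: of_nat_power)
  then have fin: "finite (carrier G)" using pos D(1) by (intro card_ge_0_finite) simp
  have cH: "card H = D"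
    using l_lagrange[OF fin H] idx cG pos by (auto simp: order_def)
  have HD: "g [^] D = \<one>" if "g \<in> H" for g
  proof -
    interpret HG: group "G\<lparr>carrier := H\<rparr>" by (rule subgroup_imp_group[OF H])
    have "g [^]\<^bsub>G\<lparr>carrier := H\<rparr>\<^esub> order (G\<lparr>carrier := H\<rparr>) = \<one>"
      using HG.pow_order_eq_1[of g] that by simp
    then show ?thesis using cH by (simp add: order_def nat_pow_consistent[symmetric])
  qed
  have Hc: "g \<in> carrier G" if "g \<in> H" for g using subgroup.mem_carrier[OF H that] .
  have pow: "c [^] i \<in> H \<longleftrightarrow> int ?m dvd i" for i :: int
  proof
    assume "c [^] i \<in> H"
    then have "(c [^] i) [^] int D = \<one>" using HD by (simp add: int_pow_int)
    then have "c [^] (i * int D) = \<one>" using c(1) by (simp add: int_pow_pow)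
    then have "int ?m dvd i * int D" using int_pow_eq_id[OF c(1)] ord by simp
    moreover have "coprime (int ?m) (int D)" using copD by (simp only: coprime_int_iff)
    ultimately show "int ?m dvd i" by (simp only: coprime_dvd_mult_left_iff)
  next
    assume "int ?m dvd i"
    then have "c [^] i = \<one>" using int_pow_eq_id[OF c(1)] ord by simp
    then show "c [^] i \<in> H" using subgroup.one_closed[OF H] by simp
  qed
  let ?e = "\<lambda>i::int. (c [^] i) <# H"
  note e = coordinate_cosets[OF H c(1) pos idx pow]
  have cycle: "prime_power_cycle p n (lcosets H) ?e" using p e by unfold_locales
  interpret prime_power_cycle p n "lcosets H" ?e by (rule cycle)
  have conj: "g \<otimes> c = c [^] nat (\<phi> (snd (f g)) 1) \<otimes> g" if g: "g \<in> carrier G" for g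
  proof (rule finj)
    let ?r = "nat (\<phi> (snd (f g)) 1)"
    have r: "\<phi> (snd (f g)) 1 \<in> {0..<int ?m}"
      using AutoGroup_integer_mod_group_apply(1)[OF \<phi>c[OF fc(2)[OF g]] m1] .
    show "f (g \<otimes> c) = f (c [^] ?r \<otimes> g)"
      using fm[OF g c(1)] fm[of "c [^] ?r" g] g c r fpow[of ?r] \<phi>0[OF fc(1)[OF g]] fc(2)[OF g]
      by (simp add: add.commute)
  qed (use g c in simp_all)
  have act: "coset_action G H g (?e (int k)) = (c [^] (nat (\<phi> (snd (f g)) 1) * k)) <# (g <# H)"
    if g: "g \<in> carrier G" for g k
    using conj_pow[OF g c(1) conj[OF g], of k] g c(1) subgroup.subset[OF H]
    by (simp add: coset_action_apply[OF H] int_pow_int lcos_m_assoc)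
  \<comment> \<open>If \<open>g <# H\<close> has label \<open>l\<close>, then \<open>g\<close> acts
    on labels as \<open>k \<mapsto> r * k + l\<close> and conjugates translation by \<open>j\<close>
    into translation by \<open>r * j\<close>.\<close>
  have norm: "normalizes (lcosets H) (coset_action G H g) (range (shift (lcosets H) ?e))"
    if g: "g \<in> carrier G" for g
    unfolding normalizes_def
  proof
    let ?r = "nat (\<phi> (snd (f g)) 1)"
    have "g <# H \<in> lcosets H" using g unfolding LCOSETS_def by blast
    then obtain l where l: "g <# H = ?e l" by (rule coordinateE[OF e])
    have act': "coset_action G H g (?e (int k)) = ?e (int (?r * k) + l)" for k
      using act[OF g, of k] c(1) subgroup.subset[OF H] unfolding l
      by (simp add: lcos_m_assoc int_pow_mult int_pow_int[symmetric])
    fix \<eta> assume "\<eta> \<in> range (shift (lcosets H) ?e)"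
    then obtain i where "\<eta> = shift (lcosets H) ?e i" by blast
    then have \<eta>: "\<eta> = shift (lcosets H) ?e (int (nat (i mod int ?m)))" (is "_ = shift _ _ (int ?j)")
      using pos by (simp add: shift_eq_iff[OF e] cong_def del: of_nat_power)
    have "coset_action G H g (\<eta> x) = shift (lcosets H) ?e (int (?r * ?j)) (coset_action G H g x)"
      if x: "x \<in> lcosets H" for x
    proof -
      obtain k :: nat where k: "x = ?e (int k)" by (rule coordinate_nat[OF e pos x])
      have \<eta>x: "\<eta> x = ?e (int (k + ?j))" unfolding k \<eta> shift_apply[OF e] by (simp only: of_nat_add)
      have "coset_action G H g (\<eta> x) = ?e (int (?r * (k + ?j)) + l)" unfolding \<eta>x by (rule act')
      also have "\<dots> = shift (lcosets H) ?e (int (?r * ?j)) (?e (int (?r * k) + l))"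
        unfolding shift_apply[OF e] by (simp only: distrib_left of_nat_add ac_simps)
      finally show ?thesis unfolding k act' .
    qed
    then show "\<exists>\<eta>'\<in>range (shift (lcosets H) ?e).
        \<forall>x\<in>lcosets H. coset_action G H g (\<eta> x) = \<eta>' (coset_action G H g x)" by blast
  qed
  have "\<exists>d \<in> H. d \<noteq> \<one>"
  proof (rule ccontr)
    assume "\<not> (\<exists>d \<in> H. d \<noteq> \<one>)"
    then have "H \<subseteq> {\<one>}" by blast
    then have "card H \<le> 1" using card_mono[of "{\<one>}" H] by simp
    then show False using cH D(1) by simp
  qed
  then obtain d where d: "d \<in> H" "d \<noteq> \<one>" by blast
  have dc: "d \<in> carrier G" using Hc[OF d(1)] .
  let ?b = "snd (f d)" and ?r = "nat (\<phi> (snd (f d)) 1)"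
  \<comment> \<open>Otherwise \<open>d\<close> would be a power of \<open>c\<close> inside
    \<open>H\<close>, hence trivial.\<close>
  have b0: "?b \<noteq> 0"
  proof
    assume b: "?b = 0"
    have "f d = f (c [^] nat (fst (f d)))" unfolding fpow using fc(1)[OF dc] b by (simp add: prod_eq_iff)
    then have dpow: "d = c [^] nat (fst (f d))" using finj[OF dc] c(1) by simp
    then have "c [^] int (nat (fst (f d))) \<in> H" using d(1) unfolding int_pow_int by (rule subst)
    then have "int ?m dvd fst (f d)" using pow fc(1)[OF dc] by simp
    then have "fst (f d) = 0"
      using fc(1)[OF dc] by (metis atLeastLessThan_iff dvd_imp_mod_0 mod_pos_pos_trivial)
    then show False using dpow d(2) by simp
  qed
  have r: "\<phi> ?b 1 \<in> {0..<int ?m}"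
    using AutoGroup_integer_mod_group_apply(1)[OF \<phi>c[OF fc(2)[OF dc]] m1] .
  \<comment> \<open>Here faithfulness of the action enters: multiplier 1 would mean
    \<open>\<phi> ?b = \<phi> 0\<close>.\<close>
  have r1: "\<phi> ?b 1 \<noteq> 1"
  proof
    assume "\<phi> ?b 1 = 1"
    then have "\<phi> ?b = \<phi> 0"
      using \<phi>0[of 1] m1i D(1)
      by (intro AutoGroup_integer_mod_group_eqI[OF \<phi>c[OF fc(2)[OF dc]] \<phi>c m1]) simp_all
    then show False
      using inj_onD[OF \<phi>(2), of ?b 0] fc(2)[OF dc] b0 D(1) by (simp add: carrier_integer_mod_group)
  qed
  have "c [^] (?r ^ D) = c [^] (1::nat)"
    using pow_conj[OF dc c(1) conj[OF dc], of D] HD[OF d(1)] c(1) by simp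
  then have "f (c [^] (?r ^ D)) = f (c [^] (1::nat))" by simp
  then have rD: "[int ?r ^ D = 1] (mod int p ^ n)"
    unfolding fpow by (simp add: cong_def)
  \<comment> \<open>From \<open>r ^ D \<equiv> 1\<close> with \<open>D\<close> prime to
    \<open>p\<close>, a congruence \<open>r \<equiv> 1\<close> modulo \<open>p\<close> would lift to
    \<open>p ^ n\<close>, against \<open>r1\<close>.\<close>
  have r_not: "\<not> [int ?r = 1] (mod int p)"
  proof
    assume "[int ?r = 1] (mod int p)"
    then have "[int ?r = 1] (mod int p ^ n)" by (rule cong_1_of_power[OF p(1) _ pD rD])
    then show False using r r1 m1i by (simp add: cong_def)
  qed
  have r_pos: "?r \<ge> 1"
  proof (rule ccontr)
    assume "\<not> ?r \<ge> 1"
    then have "?r = 0" by simp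
    then have "[0 = 1] (mod int p ^ n)" using rD D(1) by (simp add: power_0_left)
    then show False using m1i by (simp add: cong_def)
  qed
  \<comment> \<open>\<open>d\<close> lies in \<open>H\<close>, so it fixes the base coset and acts
    as pure multiplication by \<open>?r\<close>.\<close>
  have d_act: "coset_action G H d (?e (int k)) = ?e (int (?r * k))" for k
    unfolding act[OF dc] coset_join3[OF dc H d(1)] by (simp only: int_pow_int)
  have "shift (lcosets H) ?e 1 \<in> coset_action G H ` carrier G"
    using coset_action_pow[OF H c(1) e, of 1] c(1) by (metis imageI int_pow_closed)
  then have "cyclic_regular (coset_action G H ` carrier G) = {range (shift (lcosets H) ?e)}"
    using norm coset_action_Bij[OF H dc] d_act r_pos r_not dc
    by (intro cyclic_regular_unique[where d = "coset_action G H d" and r = ?r]) auto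
  then show ?thesis unfolding normalized_cyclic_regular_eq[OF H cycle] by simp
qed

end

section \<open>Counting Hopf Galois structures\<close>

lemma hopf_galois_structures_of_cyclic_type:
  "hopf_galois_structures_of_type E K L (integer_mod_group m) =
     normalized_cyclic_regular (galois_group E K) (carrier (galois_group E L)) m"
  unfolding hopf_galois_structures_of_type_def hopf_galois_structures_def
    normalized_cyclic_regular_def Let_def by blast

lemma (in field) galois_group_of_top:
  assumes "K \<subseteq> carrier R"
  shows "carrier (galois_group R (carrier R)) = {\<one>\<^bsub>galois_group R K\<^esub>}"
proof -
  have one: "\<one>\<^bsub>galois_group R K\<^esub> = (\<lambda>x\<in>carrier R. x)"
    by (simp add: galois_group_def BijGroup_def)
  show ?thesis
  proof (intro equalityI subsetI)
    fix t assume t: "t \<in> carrier (galois_group R (carrier R))"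
    have "t = (\<lambda>x\<in>carrier R. x)"
      using galois_groupD(1,3)[OF t] Bij_imp_extensional
      by (intro extensionalityI[of _ "carrier R"]) auto
    then show "t \<in> {\<one>\<^bsub>galois_group R K\<^esub>}" using one by simp
  next
    fix t assume "t \<in> {\<one>\<^bsub>galois_group R K\<^esub>}"
    then show "t \<in> carrier (galois_group R (carrier R))"
      using subgroup.one_closed[OF subgroup_galois_group[OF assms subset_refl]] by simp
  qed
qed

theorem proposition5:
  fixes E :: "('a, 'b) ring_scheme" and K L :: "'a set" and p n :: nat
  assumes "Factorial_Ring.prime p" and "odd p" and "n \<ge> 2"
    and "field E" and "subfield K E" and "subfield L E" and "K \<subseteq> L"
    and "ring.dimension E (p ^ n) K L"
    and "is_normal_closure E K L"
    and "separable_extension E K L"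
  shows "(galois_extension E K L \<and> cyclic_group (galois_group (E\<lparr>carrier := L\<rparr>) K) \<longrightarrow>
            card (hopf_galois_structures_of_type E K L (integer_mod_group (p ^ n))) = p ^ (n - 1)) \<and>
         (\<forall>D \<phi>. D > 1 \<and> D dvd p - 1 \<and>
            \<phi> \<in> hom (integer_mod_group D) (AutoGroup (integer_mod_group (p ^ n))) \<and>
            inj_on \<phi> (carrier (integer_mod_group D)) \<and>
            galois_group E K \<cong> semidirect_product (integer_mod_group (p ^ n)) (integer_mod_group D) \<phi> \<longrightarrow>
            card (hopf_galois_structures_of_type E K L (integer_mod_group (p ^ n))) = 1)"
proof (intro conjI allI impI)
  interpret E: field E by fact
  have L: "L \<subseteq> carrier E" using subfieldE(3)[OF assms(6)] .
  then have K: "K \<subseteq> carrier E" using assms(7) by blast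
  interpret G: group "galois_group E K" by (rule E.group_galois_group[OF K])
  let ?H = "carrier (galois_group E L)"
  have H: "subgroup ?H (galois_group E K)" by (rule E.subgroup_galois_group[OF assms(7) L])
  have n: "n \<ge> 1" using assms(3) by simp
  have normal: "normal_extension K E" and
    minimal: "\<And>M. subfield M E \<Longrightarrow> L \<subseteq> M \<Longrightarrow> normal_extension K (E\<lparr>carrier := M\<rparr>) \<Longrightarrow> M = carrier E"
    using assms(9) unfolding is_normal_closure_def by blast+
  \<comment> \<open>The degree of \<open>L\<close> over \<open>K\<close> becomes the number of
    points on which the regular subgroups act.\<close>
  have idx: "card (lcosets\<^bsub>galois_group E K\<^esub> ?H) = p ^ n"
    by (rule E.card_lcosets_galois_eq_dimension[OF assms(5-8) normal assms(10)])
  {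
    assume *: "galois_extension E K L \<and> cyclic_group (galois_group (E\<lparr>carrier := L\<rparr>) K)"
    \<comment> \<open>A normal \<open>L\<close> is its own normal closure, so \<open>G'\<close> is
      trivial and \<open>G\<close> is the given cyclic group.\<close>
    then have top: "L = carrier E"
      using minimal[OF assms(6) subset_refl] unfolding galois_extension_def by blast
    then have "E\<lparr>carrier := L\<rparr> = E" by simp
    then have "cyclic_group (galois_group E K)" using * by simp
    then show "card (hopf_galois_structures_of_type E K L (integer_mod_group (p ^ n))) = p ^ (n - 1)"
      unfolding hopf_galois_structures_of_cyclic_type
      using G.card_normalized_cyclic_regular_cyclic[OF assms(1,2) n _ idx] E.galois_group_of_top[OF K]
      by (simp add: top)
  next
    fix D \<phi>
    assume "D > 1 \<and> D dvd p - 1 \<and>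
      \<phi> \<in> hom (integer_mod_group D) (AutoGroup (integer_mod_group (p ^ n))) \<and>
      inj_on \<phi> (carrier (integer_mod_group D)) \<and>
      galois_group E K \<cong> semidirect_product (integer_mod_group (p ^ n)) (integer_mod_group D) \<phi>"
    then show "card (hopf_galois_structures_of_type E K L (integer_mod_group (p ^ n))) = 1"
      unfolding hopf_galois_structures_of_cyclic_type
      using G.card_normalized_cyclic_regular_semidirect[OF assms(1,2) n H idx] by blast
  }
qed

end
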